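(* Let $X$ be a curve over a finite field, $S$ a finite set of rational points, $C$ a divisor, and $Q_0,\ldots,Q_{r-1}\in S$. Define $C_0=C$ and $C_{i+1}=C_i+Q_i$ for $i=0,\ldots,r-1$. Then \[ \gamma^\ast(C;S)\geq\min\big(\{\gamma_{Q_0}(C_0;S),\gamma_{Q_1}(C_1;S),\ldots,\gamma_{Q_{r-1}}(C_{r-1};S),\gamma^\ast(C_r;S)\}\setminus\{0\}\big), \] and $\gamma^\ast(C_r;S)\geq\deg C+r$.
   Context: $L(E)=\{f:(f)+E\ge0\}\cup\{0\}$; for a rational point $P$, $\Gamma_P=\{A:L(A)\neq L(A-P)\}$ (divisor classes), and $\Gamma_S=\bigcap_{P\in S}\Gamma_P$. For $P\in S$: $\Gamma_P(C;S)=\{A\in\Gamma_S: A-C\in\Gamma_P\}$ and $\gamma_P(C;S)$ is the minimal degree of an element of $\Gamma_P(C;S)$. Also $\Gamma^\ast(C;S)=\{A\in\Gamma_S: L(A-C)\neq L(-C)\}$ and $\gamma^\ast(C;S)$ is the minimal degree of an element of $\Gamma^\ast(C;S)$.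
   Formalization: Since L(A−C)≠L(−C) depends on the divisor A and not only on its class, Γ*(C;S) is taken to be the classes in Γ_S that have an effective representative A with L(A−C)≠L(−C); for nonempty S this amounts to the dimensions of the two spaces being different. *)

theory Defs
  imports
    "HOL-Algebra.Algebraic_Closure_Type"
    "HOL-Algebra.Generated_Fields"
    "HOL-Algebra.Free_Abelian_Groups"
    "HOL-Library.Extended_Real"
begin

text \<open>
  A (smooth, projective, absolutely irreducible) curve over a finite field is given by its
  function field: the type \<open>'f\<close> is the field of rational functions and \<open>K\<close> the
  finite field of constants. Since \<open>K\<close> is perfect, absolute irreducibility amounts to
  \<open>K\<close> being algebraically closed in \<open>'f\<close>.
\<close>

abbreviation fring :: "'f::field ring" where
  "fring \<equiv> ring_of_type_algebra"

locale finite_field_curve =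
  fixes K :: "'f::field set"
  assumes subfield_K: "subfield K (fring :: 'f ring)"
    and finite_K: "finite K"
    and full_constants: "\<And>x :: 'f. ring.algebraic fring K x \<Longrightarrow> x \<in> K"
    and function_field: "\<exists>x :: 'f. ring.transcendental fring K x \<and>
          ring.finite_dimension fring (generate_field fring (insert x K)) UNIV"

text \<open>
  A closed point of the curve is identified with its order function \<open>v\<close>, a normalized
  discrete valuation of the function field that is trivial on the constants. The value
  \<open>v 0\<close>, mathematically infinite, is fixed to be \<open>0\<close>, so that distinct
  functions are distinct points; every use of \<open>v f\<close> below is guarded by
  \<open>f \<noteq> 0\<close>.
\<close>

type_synonym 'f point = "'f \<Rightarrow> int"

definition points :: "'f::field set \<Rightarrow> 'f point set" where
  "points K = {v. v 0 = 0
     \<and> (\<forall>f g. f \<noteq> 0 \<and> g \<noteq> 0 \<longrightarrow> v (f * g) = v f + v g)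
     \<and> (\<forall>f g. f \<noteq> 0 \<and> g \<noteq> 0 \<and> f + g \<noteq> 0 \<longrightarrow> min (v f) (v g) \<le> v (f + g))
     \<and> (\<exists>t. t \<noteq> 0 \<and> v t = 1)
     \<and> (\<forall>c\<in>K. c \<noteq> 0 \<longrightarrow> v c = 0)}"

definition local_ring :: "'f::field point \<Rightarrow> 'f ring" where
  "local_ring v = fring\<lparr>carrier := {f. f = 0 \<or> 0 \<le> v f}\<rparr>"

definition max_ideal :: "'f::field point \<Rightarrow> 'f set" where
  "max_ideal v = {f. f = 0 \<or> 1 \<le> v f}"

definition residue_field :: "'f::field point \<Rightarrow> 'f set ring" where
  "residue_field v = local_ring v Quot max_ideal v"

definition point_degree :: "'f::field set \<Rightarrow> 'f point \<Rightarrow> nat" where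
  "point_degree K v = ring.dim (residue_field v)
     ((\<lambda>c. max_ideal v +>\<^bsub>local_ring v\<^esub> c) ` K) (carrier (residue_field v))"

definition rational_points :: "'f::field set \<Rightarrow> 'f point set" where
  "rational_points K = {P \<in> points K. point_degree K P = 1}"

text \<open>
  Divisors are elements of the free abelian group on the points; \<open>frag_of P\<close> is the
  point \<open>P\<close> regarded as a divisor.
\<close>

type_synonym 'f divisor = "'f point \<Rightarrow>\<^sub>0 int"

definition divisors :: "'f::field set \<Rightarrow> 'f divisor set" where
  "divisors K = {D. Poly_Mapping.keys D \<subseteq> points K}"

definition effective :: "'f divisor \<Rightarrow> bool" where
  "effective D \<longleftrightarrow> (\<forall>P. 0 \<le> Poly_Mapping.lookup D P)"

definition divisor_degree :: "'f::field set \<Rightarrow> 'f divisor \<Rightarrow> int" where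
  "divisor_degree K D =
     (\<Sum>P\<in>Poly_Mapping.keys D. Poly_Mapping.lookup D P * int (point_degree K P))"

text \<open>The principal divisor \<open>(f)\<close> has the coefficient \<open>P f\<close> at the point \<open>P\<close>.\<close>

definition RR_space :: "'f::field set \<Rightarrow> 'f divisor \<Rightarrow> 'f set" where
  "RR_space K E = {f. f \<noteq> 0 \<and> (\<forall>P\<in>points K. 0 \<le> P f + Poly_Mapping.lookup E P)} \<union> {0}"

definition linear_equivalence :: "'f::field set \<Rightarrow> ('f divisor \<times> 'f divisor) set" where
  "linear_equivalence K = {(A, B). A \<in> divisors K \<and> B \<in> divisors K \<and>
     (\<exists>f. f \<noteq> 0 \<and> (\<forall>P\<in>points K. Poly_Mapping.lookup (A - B) P = P f))}"

definition divisor_classes :: "'f::field set \<Rightarrow> 'f divisor set set" where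
  "divisor_classes K = divisors K // linear_equivalence K"

text \<open>Linearly equivalent divisors have the same degree, so the image below is a singleton.\<close>

definition class_degree :: "'f::field set \<Rightarrow> 'f divisor set \<Rightarrow> int" where
  "class_degree K a = the_elem (divisor_degree K ` a)"

text \<open>The class of \<open>A - C\<close>, where \<open>a\<close> is the class of \<open>A\<close>.\<close>

definition class_minus :: "'f divisor set \<Rightarrow> 'f divisor \<Rightarrow> 'f divisor set" where
  "class_minus a C = (\<lambda>A. A - C) ` a"

text \<open>The condition \<open>L(A) \<noteq> L(A - P)\<close> does not depend on the representative \<open>A\<close>.\<close>

definition Gamma_pt :: "'f::field set \<Rightarrow> 'f point \<Rightarrow> 'f divisor set set" where
  "Gamma_pt K P = {a \<in> divisor_classes K.
     \<exists>A\<in>a. RR_space K A \<noteq> RR_space K (A - frag_of P)}"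

definition Gamma_set :: "'f::field set \<Rightarrow> 'f point set \<Rightarrow> 'f divisor set set" where
  "Gamma_set K S = {a \<in> divisor_classes K. \<forall>P\<in>S. a \<in> Gamma_pt K P}"

definition Gamma_rel ::
    "'f::field set \<Rightarrow> 'f point \<Rightarrow> 'f divisor \<Rightarrow> 'f point set \<Rightarrow> 'f divisor set set" where
  "Gamma_rel K P C S = {a \<in> Gamma_set K S. class_minus a C \<in> Gamma_pt K P}"

text \<open>
  The condition \<open>L(A - C) \<noteq> L(-C)\<close> compares two subspaces of the function field and is
  not invariant under replacing \<open>A\<close> by an arbitrary equivalent divisor (a nonzero principal
  \<open>A\<close> can satisfy it, although its class is that of \<open>0\<close>). It is therefore read for an
  effective representative \<open>A\<close>, for which \<open>L(-C) \<subseteq> L(A - C)\<close>; there it says that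
  the dimensions differ, and so does not depend on which effective representative is taken.
  If \<open>S\<close> is nonempty, every class in \<open>Gamma_set K S\<close> has an effective representative.
\<close>

definition Gamma_star ::
    "'f::field set \<Rightarrow> 'f divisor \<Rightarrow> 'f point set \<Rightarrow> 'f divisor set set" where
  "Gamma_star K C S = {a \<in> Gamma_set K S.
     \<exists>A\<in>a. effective A \<and> RR_space K (A - C) \<noteq> RR_space K (- C)}"

text \<open>
  The minimal degree as an extended real: over a nonempty set of classes with degrees bounded
  below the infimum is attained, over the empty set it is \<open>\<infinity>\<close>.
\<close>

definition min_degree :: "'f::field set \<Rightarrow> 'f divisor set set \<Rightarrow> ereal" where
  "min_degree K G = (INF a\<in>G. ereal (of_int (class_degree K a)))"

definition gamma_pt ::
    "'f::field set \<Rightarrow> 'f point \<Rightarrow> 'f divisor \<Rightarrow> 'f point set \<Rightarrow> ereal" where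
  "gamma_pt K P C S = min_degree K (Gamma_rel K P C S)"

definition gamma_star :: "'f::field set \<Rightarrow> 'f divisor \<Rightarrow> 'f point set \<Rightarrow> ereal" where
  "gamma_star K C S = min_degree K (Gamma_star K C S)"

end

theory Submission
  imports Defs
begin

text \<open>
  Since the constant field \<open>K\<close> is finite, dimensions can be replaced by cardinalities. The main
  tool is that \<open>L(D) \<noteq> 0\<close> implies \<open>deg D \<ge> 0\<close>. If \<open>T\<close> is a set of
  representatives modulo an element \<open>g\<close> of a subring, the sums
  \<open>a\<^sub>0 + a\<^sub>1 g + \<dots> + a\<^sub>m\<^sub>-\<^sub>1 g\<^sup>m\<^sup>-\<^sup>1\<close>
  with digits in \<open>T\<close> are pairwise distinct, so any bound of the form \<open>E C\<^sup>m\<close> for their number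
  gives \<open>|T| \<le> C\<close>. Finiteness of the field over \<open>K(x)\<close> gives such a bound for every \<open>g\<close>; this
  yields finite residue fields, finitely many zeros and poles, and the existence of a pole for every
  nonconstant function. For a nonzero \<open>g\<close> in \<open>L(D)\<close> the bound comes from the Riemann-Roch spaces
  themselves and compares the negative with the positive part of \<open>D\<close>.

  For the proposition, take an effective \<open>A\<close> in a class of \<open>\<Gamma>\<^sup>*(C;S)\<close>. If
  \<open>L(A - C\<^sub>r) = L(-C\<^sub>r)\<close>, consider a step \<open>i\<close> at which \<open>L(A - C\<^sub>i) \<noteq> L(-C\<^sub>i)\<close> turns into
  equality. Since \<open>Q\<^sub>i\<close> is rational, \<open>L(A - C\<^sub>i)\<close> drops at this step while \<open>L(-C\<^sub>i)\<close> does not. The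
  former puts the class into \<open>\<Gamma>\<^sub>Q(C\<^sub>i;S)\<close> for \<open>Q = Q\<^sub>i\<close>, and the latter excludes the zero class
  from that set, so that the corresponding minimum is not \<open>0\<close>.
\<close>

section \<open>Growth of digit sums\<close>

text \<open>Subrings are plain subsets of the field, so type-class arithmetic applies to them.
  Closure under differences supplies 0, negatives and sums.\<close>

definition unital_subring :: "'f::field set \<Rightarrow> bool" where
  "unital_subring R \<longleftrightarrow> 1 \<in> R \<and> (\<forall>a\<in>R. \<forall>b\<in>R. a - b \<in> R \<and> a * b \<in> R)"

lemma unital_subringD:
  assumes "unital_subring R"
  shows "1 \<in> R" "0 \<in> R" "a \<in> R \<Longrightarrow> b \<in> R \<Longrightarrow> a - b \<in> R" "a \<in> R \<Longrightarrow> b \<in> R \<Longrightarrow> a * b \<in> R"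
    "a \<in> R \<Longrightarrow> - a \<in> R" "a \<in> R \<Longrightarrow> b \<in> R \<Longrightarrow> a + b \<in> R"
proof -
  show 1: "1 \<in> R" and d: "\<And>a b. a \<in> R \<Longrightarrow> b \<in> R \<Longrightarrow> a - b \<in> R"
    and "a \<in> R \<Longrightarrow> b \<in> R \<Longrightarrow> a * b \<in> R"
    using assms unfolding unital_subring_def by auto
  show 0: "0 \<in> R" using d[OF 1 1] by simp
  show m: "\<And>a. a \<in> R \<Longrightarrow> - a \<in> R" using d[OF 0] by simp
  show "a \<in> R \<Longrightarrow> b \<in> R \<Longrightarrow> a + b \<in> R" using d[OF _ m, of a b] by simp
qed

lemma unital_subring_sum:
  assumes "unital_subring R" "\<And>i. i \<in> I \<Longrightarrow> f i \<in> R"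
  shows "(\<Sum>i\<in>I. f i) \<in> R"
  using assms(2) by (induction I rule: infinite_finite_induct) (auto intro: unital_subringD[OF assms(1)])

lemma unital_subring_power:
  assumes "unital_subring R" "a \<in> R" shows "a ^ n \<in> R"
  by (induction n) (auto intro: unital_subringD[OF assms(1)] assms)

section \<open>Translation between HOL-Algebra and type-class fields\<close>

lemma carrier_fring [simp]: "carrier fring = UNIV"
  and mult_fring [simp]: "x \<otimes>\<^bsub>fring\<^esub> y = x * y"
  and one_fring [simp]: "\<one>\<^bsub>fring\<^esub> = 1"
  and zero_fring [simp]: "\<zero>\<^bsub>fring\<^esub> = 0"
  and add_fring [simp]: "x \<oplus>\<^bsub>fring\<^esub> y = x + y"
  by (simp_all add: ring_of_type_algebra_def)

lemma a_inv_fring [simp]: "\<ominus>\<^bsub>fring\<^esub> (x :: 'f::field) = - x"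
proof -
  interpret ring "fring :: 'f ring" by (rule ring_from_type_algebra)
  show ?thesis using minus_equality[of "- x" x] by simp
qed

lemma m_inv_fring [simp]:
  assumes "(x :: 'f::field) \<noteq> 0" shows "inv\<^bsub>fring\<^esub> x = inverse x"
proof -
  interpret ring "fring :: 'f ring" by (rule ring_from_type_algebra)
  show ?thesis using inv_unique'[of x "inverse x"] assms by simp
qed

lemma subring_unital_subring:
  assumes "subring R (fring :: 'f::field ring)" shows "unital_subring R"
proof -
  have "a + - b \<in> R \<and> a * b \<in> R" if "a \<in> R" "b \<in> R" for a b
    using subringE(5,6,7)[OF assms] that by (metis a_inv_fring add_fring mult_fring)
  then show ?thesis
    using subringE(3)[OF assms] by (simp add: unital_subring_def)
qed

text \<open>Elements with a denominator in \<open>B\<close> are closed under the field operations.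
  For an inverse, the cleared numerator \<open>b * h\<close> becomes the new denominator.\<close>

lemma generate_field_fractions:
  assumes B: "unital_subring B" and H: "H \<subseteq> B"
    and c: "c \<in> generate_field (fring :: 'f::field ring) H"
  shows "\<exists>b\<in>B. b \<noteq> 0 \<and> b * c \<in> B"
  using c
proof (induction rule: generate_field.induct)
  case one
  then show ?case using unital_subringD[OF B] by (auto intro!: bexI[of _ 1])
next
  case (incl h)
  then show ?case using unital_subringD[OF B] H by (auto intro!: bexI[of _ 1])
next
  case (a_inv h)
  then show ?case using unital_subringD(5)[OF B] by auto
next
  case (m_inv h)
  then obtain b where b: "b \<in> B" "b \<noteq> 0" "b * h \<in> B" by auto
  have "h \<noteq> 0" using m_inv.hyps by simp
  then have "b * h * inv\<^bsub>fring\<^esub> h = b" by (simp add: mult.assoc)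
  with b \<open>h \<noteq> 0\<close> have "b * h \<noteq> 0 \<and> b * h * inv\<^bsub>fring\<^esub> h \<in> B" by (metis no_zero_divisors)
  with b show ?case by (auto simp only: mult_fring)
next
  case (eng_add h1 h2)
  then obtain b b' where b: "b \<in> B" "b \<noteq> 0" "b * h1 \<in> B" "b' \<in> B" "b' \<noteq> 0" "b' * h2 \<in> B" by auto
  have "b * b' * (h1 + h2) = b' * (b * h1) + b * (b' * h2)" by (simp add: algebra_simps)
  then show ?case using b unital_subringD[OF B] by (intro bexI[of _ "b * b'"]) auto
next
  case (eng_mult h1 h2)
  then obtain b b' where b: "b \<in> B" "b \<noteq> 0" "b * h1 \<in> B" "b' \<in> B" "b' \<noteq> 0" "b' * h2 \<in> B" by auto
  have "b * b' * (h1 * h2) = (b * h1) * (b' * h2)" by (simp add: algebra_simps)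
  then have "b * b' * (h1 * h2) \<in> B" using b unital_subringD(4)[OF B] by metis
  then show ?case using b unital_subringD(4)[OF B] by (intro bexI[of _ "b * b'"]) auto
qed

lemma common_denominator:
  assumes B: "unital_subring (B :: 'f::field set)" and "finite I"
    and "\<And>i. i \<in> I \<Longrightarrow> \<exists>b\<in>B. b \<noteq> 0 \<and> b * c i \<in> B"
  shows "\<exists>b\<in>B. b \<noteq> 0 \<and> (\<forall>i\<in>I. b * c i \<in> B)"
  using assms(2,3)
proof (induction I)
  case empty
  then show ?case using unital_subringD(1)[OF B] by (auto intro!: bexI[of _ 1])
next
  case (insert i I)
  obtain b where b: "b \<in> B" "b \<noteq> 0" "\<forall>i\<in>I. b * c i \<in> B" using insert by auto
  obtain b' where b': "b' \<in> B" "b' \<noteq> 0" "b' * c i \<in> B" using insert.prems[of i] by auto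
  have "b * b' * c i = b * (b' * c i)" "\<And>j. b * b' * c j = b' * (b * c j)"
    by (simp_all add: algebra_simps)
  then have "b * b' * c i \<in> B" "\<And>j. j \<in> I \<Longrightarrow> b * b' * c j \<in> B"
    using b b' unital_subringD(4)[OF B] by metis+
  then show ?case using b b' unital_subringD(4)[OF B] by (intro bexI[of _ "b * b'"]) auto
qed

lemma dimension_spanning:
  assumes "ring.dimension (fring :: 'f::field ring) n L E" and "0 \<in> L"
  shows "\<exists>u :: nat \<Rightarrow> 'f. \<forall>e\<in>E. \<exists>c. (\<forall>j. c j \<in> L) \<and> e = (\<Sum>j<n. c j * u j)"
proof -
  interpret ring "fring :: 'f ring" by (rule ring_from_type_algebra)
  from assms(1) have "dimension n L E" .
  then show ?thesis using assms(2)
  proof (induction n L E rule: dimension.induct)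
    case (zero_dim K)
    then show ?case by auto
  next
    case (Suc_dim v E n K)
    then obtain u where u: "\<forall>e\<in>E. \<exists>c. (\<forall>j. c j \<in> K) \<and> e = (\<Sum>j<n. c j * u j)" by auto
    show ?case
    proof (rule exI[of _ "u(n := v)"], rule ballI)
      fix e assume "e \<in> line_extension K v E"
      then obtain k e' where e: "k \<in> K" "e' \<in> E" "e = k * v + e'"
        unfolding line_extension_def set_add_def set_mult_def r_coset_def by auto
      obtain c where c: "\<forall>j. c j \<in> K" "e' = (\<Sum>j<n. c j * u j)" using u e by auto
      have "(\<Sum>j<n. (c(n := k)) j * (u(n := v)) j) = (\<Sum>j<n. c j * u j)"
        by (intro sum.cong) auto
      then show "\<exists>c. (\<forall>j. c j \<in> K) \<and> e = (\<Sum>j<Suc n. c j * (u(n := v)) j)"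
        using c e by (intro exI[of _ "c(n := k)"]) auto
    qed
  qed
qed

lemma finite_nat_bound:
  assumes "finite I" "\<And>i. i \<in> I \<Longrightarrow> \<exists>e::nat. P i e" "\<And>i e e'. P i e \<Longrightarrow> e \<le> e' \<Longrightarrow> P i e'"
  shows "\<exists>e. \<forall>i\<in>I. P i e"
  using assms(1,2)
proof (induction I)
  case (insert i I)
  obtain e where "\<forall>i\<in>I. P i e" using insert by auto
  moreover obtain e' where "P i e'" using insert by auto
  ultimately have "\<forall>j\<in>insert i I. P j (max e e')" using assms(3) by (metis insert_iff max.cobounded1 max.cobounded2)
  then show ?case by blast
qed auto

section \<open>Growth over the rational function field\<close>

context finite_field_curve
begin

lemma K_subring: "unital_subring K"
  using subring_unital_subring subfieldE(1)[OF subfield_K] by blast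

lemma K_inverse: "c \<in> K \<Longrightarrow> inverse c \<in> K"
proof -
  interpret ring "fring :: 'f ring" by (rule ring_from_type_algebra)
  assume "c \<in> K"
  then show ?thesis
    using subfield_m_inv(1)[OF subfield_K, of c] by (cases "c = 0") auto
qed

lemma card_K: "card K \<ge> 2"
proof -
  have "card {0, 1 :: 'f} \<le> card K"
    using unital_subringD(1,2)[OF K_subring] finite_K by (intro card_mono) auto
  then show ?thesis by simp
qed

text \<open>
  The field lies in finitely many copies of \<open>K(x)\<close>. After clearing denominators, the sums below
  become vectors of polynomials in \<open>x\<close> whose degree grows linearly in \<open>m\<close>, with a slope that
  depends on \<open>g\<close> only.
\<close>

lemma growth_bound:
  fixes g :: 'f
  shows "\<exists>C. \<forall>T. finite T \<longrightarrow>
    (\<exists>E. \<forall>m. card ((\<lambda>a. \<Sum>k<m. a k * g ^ k) ` ({..<m} \<rightarrow>\<^sub>E T)) \<le> E * C ^ m)"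
proof -
  obtain x where x: "ring.finite_dimension (fring :: 'f ring) (generate_field fring (insert x K)) UNIV"
    using function_field by auto
  interpret R: ring "fring :: 'f ring" by (rule ring_from_type_algebra)
  interpret R: field "fring :: 'f ring" by (rule field_from_type_algebra)
  define L where "L = generate_field (fring :: 'f ring) (insert x K)"
  have "0 \<in> L" using R.zero_in_generate unfolding L_def by auto
  obtain N where "R.dimension N L UNIV" using x unfolding R.finite_dimension_def L_def by auto
  from dimension_spanning[OF this \<open>0 \<in> L\<close>] obtain u
    where u: "\<And>e. \<exists>c. (\<forall>j. c j \<in> L) \<and> e = (\<Sum>j<N. c j * u j)" by auto
  note K = unital_subringD[OF K_subring]
  \<comment> \<open>\<open>A d\<close> collects the combinations of the spanning family
    \<open>u\<close> whose coordinates are polynomials in \<open>x\<close> over \<open>K\<close> of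
    degree at most \<open>d\<close>; it is an increasing filtration by finite sets.\<close>
  define A where "A d = {(\<Sum>j<N. \<Sum>i\<le>d. c i j * x ^ i * u j) | c. \<forall>i j. c i j \<in> K}" for d
  have A_add: "a + b \<in> A d" if "a \<in> A d" "b \<in> A d" for a b d
  proof -
    obtain c c' where c: "\<forall>i j. c i j \<in> K" "\<forall>i j. c' i j \<in> K"
      and ab: "a = (\<Sum>j<N. \<Sum>i\<le>d. c i j * x ^ i * u j)" "b = (\<Sum>j<N. \<Sum>i\<le>d. c' i j * x ^ i * u j)"
      using \<open>a \<in> A d\<close> \<open>b \<in> A d\<close> unfolding A_def by blast
    show ?thesis unfolding A_def mem_Collect_eq using c K(6) ab
      by (intro exI[of _ "\<lambda>i j. c i j + c' i j"]) (auto simp: sum.distrib algebra_simps)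
  qed
  have A_0: "0 \<in> A d" for d
    unfolding A_def mem_Collect_eq using K(2) by (intro exI[of _ "\<lambda>i j. 0"]) auto
  have A_sum: "(\<Sum>i\<in>I. f i) \<in> A d" if "\<And>i. i \<in> I \<Longrightarrow> f i \<in> A d" for I :: "nat set" and f d
    using that by (induction I rule: infinite_finite_induct) (auto intro: A_0 A_add)
  have A_K: "k * a \<in> A d" if "k \<in> K" "a \<in> A d" for a k d
  proof -
    obtain c where c: "\<forall>i j. c i j \<in> K" and ab: "a = (\<Sum>j<N. \<Sum>i\<le>d. c i j * x ^ i * u j)"
      using \<open>a \<in> A d\<close> unfolding A_def by blast
    show ?thesis unfolding A_def mem_Collect_eq using c K(4) ab that(1)
      by (intro exI[of _ "\<lambda>i j. k * c i j"]) (auto simp: sum_distrib_left algebra_simps)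
  qed
  have A_x: "x * a \<in> A (Suc d)" if "a \<in> A d" for a d
  proof -
    obtain c where c: "\<forall>i j. c i j \<in> K" and ab: "a = (\<Sum>j<N. \<Sum>i\<le>d. c i j * x ^ i * u j)"
      using \<open>a \<in> A d\<close> unfolding A_def by blast
    show ?thesis unfolding A_def mem_Collect_eq using c K(2) ab
      by (intro exI[of _ "\<lambda>i j. case i of 0 \<Rightarrow> 0 | Suc i' \<Rightarrow> c i' j"])
        (auto simp: sum.atMost_Suc_shift sum_distrib_left algebra_simps simp del: sum.atMost_Suc split: nat.splits)
  qed
  have A_mono: "a \<in> A d'" if "a \<in> A d" "d \<le> d'" for a d d'
  proof -
    obtain c where c: "\<forall>i j. c i j \<in> K" and ab: "a = (\<Sum>j<N. \<Sum>i\<le>d. c i j * x ^ i * u j)"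
      using \<open>a \<in> A d\<close> unfolding A_def by blast
    have "(\<Sum>i\<le>d'. (if i \<le> d then c i j else 0) * x ^ i * u j) = (\<Sum>i\<le>d. c i j * x ^ i * u j)" for j
      using \<open>d \<le> d'\<close> by (intro sum.mono_neutral_cong_right) auto
    then show ?thesis unfolding A_def mem_Collect_eq using c K(2) ab
      by (intro exI[of _ "\<lambda>i j. if i \<le> d then c i j else 0"]) auto
  qed
  have A_u: "u j \<in> A 0" if "j < N" for j
    unfolding A_def mem_Collect_eq using K(1,2) that
    by (intro exI[of _ "\<lambda>i l. if l = j then 1 else 0"]) (auto simp: if_distrib[of "\<lambda>c. c * _"] cong: if_cong)
  have A_card: "finite (A d) \<and> card (A d) \<le> card K ^ (Suc d * N)" for d
  proof -
    let ?F = "({..d} \<times> {..<N}) \<rightarrow>\<^sub>E K"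
    let ?s = "\<lambda>c. \<Sum>j<N. \<Sum>i\<le>d. c (i, j) * x ^ i * u j"
    have F: "finite ?F" "card ?F = card K ^ (Suc d * N)"
      by (auto simp: finite_K finite_PiE card_PiE card_cartesian_product)
    have "A d \<subseteq> ?s ` ?F"
    proof
      fix a assume "a \<in> A d"
      then obtain c where c: "\<forall>i j. c i j \<in> K" and ab: "a = (\<Sum>j<N. \<Sum>i\<le>d. c i j * x ^ i * u j)"
        unfolding A_def by blast
      show "a \<in> ?s ` ?F" using c ab
        by (intro image_eqI[of _ _ "restrict (\<lambda>(i, j). c i j) ({..d} \<times> {..<N})"]) auto
    qed
    then show ?thesis
      using F finite_subset card_mono card_image_le[OF F(1), of ?s] finite_imageI[OF F(1), of ?s]
      by (metis (no_types, lifting) order_trans)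
  qed
  \<comment> \<open>\<open>mul f e\<close> says that multiplication by \<open>f\<close> raises the
    filtration degree by at most \<open>e\<close>. These exponents add up under products, so a power
    \<open>f ^ k\<close> costs at most \<open>k * e\<close>.\<close>
  define mul where "mul f e \<longleftrightarrow> (\<forall>d. \<forall>a\<in>A d. f * a \<in> A (d + e))" for f e
  have mul_mono: "mul f e'" if "mul f e" "e \<le> e'" for f e e'
    using that unfolding mul_def by (meson A_mono add_le_cancel_left)
  have mul_K: "mul c 0" if "c \<in> K" for c using A_K that unfolding mul_def by auto
  have mul_x: "mul x 1" using A_x unfolding mul_def by auto
  have mul_add: "mul (f + f') e" if "mul f e" "mul f' e" for f f' e
    using that A_add unfolding mul_def by (auto simp: distrib_right)
  have mul_mult: "mul (f * f') (e + e')" if "mul f e" "mul f' e'" for f f' e e'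
    unfolding mul_def
  proof (intro allI ballI)
    fix d a assume "a \<in> A d"
    then have "f * (f' * a) \<in> A (d + e' + e)" using that unfolding mul_def by blast
    then show "f * f' * a \<in> A (d + (e + e'))" by (simp add: algebra_simps)
  qed
  have mul_power: "mul (f ^ k) (k * e)" if "mul f e" for f e k
    using that by (induction k) (auto intro: mul_K K(1) mul_mult)
  define B where "B = {f. \<exists>e. mul f e}"
  have B: "unital_subring B"
    unfolding unital_subring_def
  proof (intro conjI ballI)
    show "1 \<in> B" using mul_K[OF K(1)] unfolding B_def by auto
    fix a b assume "a \<in> B" "b \<in> B"
    then obtain e e' where e: "mul a e" "mul b e'" unfolding B_def by auto
    show "a * b \<in> B" using mul_mult[OF e] unfolding B_def by auto
    have "mul (-1 * b) (0 + e')" using K by (intro mul_mult mul_K e) auto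
    then have "mul (- b) e'" by simp
    then have "mul (a + - b) (max e e')"
      by (intro mul_add) (auto intro: mul_mono e)
    then show "a - b \<in> B" unfolding B_def by auto
  qed
  have L_frac: "\<exists>b\<in>B. b \<noteq> 0 \<and> b * c \<in> B" if "c \<in> L" for c
    using that unfolding L_def
    by (rule generate_field_fractions[OF B, rotated]) (use mul_K mul_x in \<open>auto simp: B_def\<close>)
  \<comment> \<open>The matrix of multiplication by \<open>f\<close> with respect to
    \<open>u\<close> has entries in \<open>L\<close>. A common denominator \<open>b\<close> moves
    all of them into \<open>B\<close>, and then \<open>b * f\<close> raises the degree by a bounded
    amount.\<close>
  have frac: "\<exists>b\<in>B. b \<noteq> 0 \<and> b * f \<in> B" for f
  proof -
    have "\<forall>i. \<exists>c. (\<forall>j. c j \<in> L) \<and> f * u i = (\<Sum>j<N. c j * u j)" using u by blast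
    then obtain c where c: "\<And>i j. c i j \<in> L" "\<And>i. f * u i = (\<Sum>j<N. c i j * u j)" by metis
    obtain b where b: "b \<in> B" "b \<noteq> 0" "\<forall>p\<in>{..<N}\<times>{..<N}. b * (case p of (i, j) \<Rightarrow> c i j) \<in> B"
      using common_denominator[OF B, of "{..<N}\<times>{..<N}" "\<lambda>(i, j). c i j"] L_frac c(1) by auto
    have "\<exists>e. \<forall>p\<in>{..<N}\<times>{..<N}. mul (b * (case p of (i, j) \<Rightarrow> c i j)) e"
      by (rule finite_nat_bound) (use b mul_mono in \<open>auto simp: B_def\<close>)
    then obtain e where e: "\<And>i j. i < N \<Longrightarrow> j < N \<Longrightarrow> mul (b * c i j) e" by auto
    have bfu: "b * f * u i \<in> A e" if "i < N" for i
    proof -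
      have "b * f * u i = (\<Sum>j<N. b * c i j * u j)"
        using c(2)[of i] by (simp add: mult.assoc sum_distrib_left)
      also have "\<dots> \<in> A e" using e[OF that] A_u unfolding mul_def by (intro A_sum) force
      finally show ?thesis .
    qed
    have "mul (b * f) e"
      unfolding mul_def
    proof (intro allI ballI)
      fix d a assume "a \<in> A d"
      then obtain k where k: "\<forall>i j. k i j \<in> K" and a: "a = (\<Sum>j<N. \<Sum>i\<le>d. k i j * x ^ i * u j)"
        unfolding A_def by blast
      have "b * f * a = (\<Sum>j<N. \<Sum>i\<le>d. k i j * (x ^ i * (b * f * u j)))"
        unfolding a by (simp add: sum_distrib_left algebra_simps)
      also have "\<dots> \<in> A (d + e)"
      proof (rule A_sum, rule A_sum, rule A_K)
        fix j i assume "j \<in> {..<N}" "i \<in> {..d}"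
        then have "x ^ i * (b * f * u j) \<in> A (e + i * 1)"
          using mul_power[OF mul_x, of i] bfu unfolding mul_def by auto
        then show "x ^ i * (b * f * u j) \<in> A (d + e)" using \<open>i \<in> {..d}\<close> by (auto elim: A_mono)
      qed (use k in auto)
      finally show "b * f * a \<in> A (d + e)" .
    qed
    then show ?thesis using b unfolding B_def by auto
  qed
  \<comment> \<open>Some \<open>u j\<close> is nonzero because the family spans 1. Multiplication by
    it carries the ring elements used below into the filtration.\<close>
  obtain c where "1 = (\<Sum>j<N. c j * u j)" using u[of 1] by auto
  then obtain j where j: "j < N" "u j \<noteq> 0" by (metis (no_types, lifting) lessThan_iff mult_zero_right sum.neutral zero_neq_one)
  obtain h where h: "h \<in> B" "h \<noteq> 0" "h * g \<in> B" using frac by auto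
  then obtain e1 e2 where "mul h e1" "mul (h * g) e2" unfolding B_def by auto
  then obtain D where D: "mul h D" "mul (h * g) D" using mul_mono by (meson max.cobounded1 max.cobounded2)
  show ?thesis
  \<comment> \<open>The slope \<open>D\<close> comes from \<open>g\<close> and its denominator
    \<open>h\<close> alone; the digit set \<open>T\<close> enters only through the offset
    \<open>e\<close>, hence through the constant factor.\<close>
  proof (rule exI[of _ "card K ^ (D * N)"], intro allI impI)
    fix T :: "'f set" assume T: "finite T"
    obtain b where b: "b \<in> B" "b \<noteq> 0" "\<forall>a\<in>T. b * a \<in> B"
      using common_denominator[OF B T, of "\<lambda>a. a"] frac by auto
    have "\<exists>e. \<forall>a\<in>T. mul (b * a) e"
      by (rule finite_nat_bound[OF T]) (use b mul_mono in \<open>auto simp: B_def\<close>)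
    then obtain e where e: "\<And>a. a \<in> T \<Longrightarrow> mul (b * a) e" by auto
    show "\<exists>E. \<forall>m. card ((\<lambda>a. \<Sum>k<m. a k * g ^ k) ` ({..<m} \<rightarrow>\<^sub>E T)) \<le> E * (card K ^ (D * N)) ^ m"
    proof (rule exI[of _ "card K ^ (Suc e * N)"], rule allI)
      fix m
      let ?S = "(\<lambda>a. \<Sum>k<m. a k * g ^ k) ` ({..<m} \<rightarrow>\<^sub>E T)"
      \<comment> \<open>The factor \<open>b\<close> clears the denominators of the digits,
        \<open>h ^ m\<close> those of the powers of \<open>g\<close>, and \<open>u j\<close> is the
        element acted upon. Since \<open>?w\<close> is nonzero, multiplication by it preserves the
        number of sums.\<close>
      let ?w = "b * h ^ m * u j"
      have "?w * s \<in> A (e + m * D)" if "s \<in> ?S" for s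
      proof -
        obtain a where a: "\<And>k. k < m \<Longrightarrow> a k \<in> T" "s = (\<Sum>k<m. a k * g ^ k)"
          using \<open>s \<in> ?S\<close> by auto
        have "?w * s = (\<Sum>k<m. (b * a k) * ((h * g) ^ k * (h ^ (m - k) * u j)))"
          unfolding a(2) sum_distrib_left
        proof (intro sum.cong refl)
          fix k assume "k \<in> {..<m}"
          then have "h ^ m = h ^ k * h ^ (m - k)" by (simp flip: power_add)
          then show "?w * (a k * g ^ k) = (b * a k) * ((h * g) ^ k * (h ^ (m - k) * u j))"
            by (simp add: power_mult_distrib algebra_simps)
        qed
        also have "\<dots> \<in> A (e + m * D)"
        proof (intro A_sum)
          fix k assume k: "k \<in> {..<m}"
          have "h ^ (m - k) * u j \<in> A (0 + (m - k) * D)"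
            using mul_power[OF D(1)] A_u[OF j(1)] unfolding mul_def by blast
          then have "(h * g) ^ k * (h ^ (m - k) * u j) \<in> A (0 + (m - k) * D + k * D)"
            using mul_power[OF D(2)] unfolding mul_def by blast
          then have "(b * a k) * ((h * g) ^ k * (h ^ (m - k) * u j)) \<in> A (0 + (m - k) * D + k * D + e)"
            using e a(1) k unfolding mul_def by blast
          moreover have "0 + (m - k) * D + k * D + e = e + m * D"
            using k by (simp flip: add_mult_distrib)
          ultimately show "(b * a k) * ((h * g) ^ k * (h ^ (m - k) * u j)) \<in> A (e + m * D)" by metis
        qed
        finally show ?thesis .
      qed
      moreover have "inj_on ((*) ?w) ?S" using b(2) h(2) j(2) by (auto simp: inj_on_def)
      ultimately have "card ?S \<le> card (A (e + m * D))"
        using A_card by (intro card_inj_on_le) auto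
      also have "\<dots> \<le> card K ^ (Suc (e + m * D) * N)" using A_card by auto
      also have "\<dots> = card K ^ (Suc e * N) * (card K ^ (D * N)) ^ m"
        by (simp add: algebra_simps flip: power_add power_mult)
      finally show "card ?S \<le> card K ^ (Suc e * N) * (card K ^ (D * N)) ^ m" .
    qed
  qed
qed

end

text \<open>Modulo \<open>g\<close> only the lowest digits remain, and these agree because
  \<open>T\<close> has pairwise incongruent elements. Cancelling \<open>g\<close> leaves shorter
  expansions.\<close>

lemma adic_digits_unique:
  assumes R: "unital_subring R" and g: "g \<in> R" "(g :: 'f::field) \<noteq> 0" and T: "T \<subseteq> R"
    and dist: "\<And>a b r. a \<in> T \<Longrightarrow> b \<in> T \<Longrightarrow> r \<in> R \<Longrightarrow> a - b = g * r \<Longrightarrow> a = b"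
    and "\<And>k. k < m \<Longrightarrow> a k \<in> T" "\<And>k. k < m \<Longrightarrow> b k \<in> T"
    and "(\<Sum>k<m. a k * g ^ k) = (\<Sum>k<m. b k * g ^ k)"
  shows "\<forall>k<m. a k = b k"
  using assms(6-8)
proof (induction m arbitrary: a b)
  case (Suc m)
  note RD = unital_subringD[OF R]
  let ?S = "\<lambda>a. \<Sum>k<m. a (Suc k) * g ^ k"
  have S: "(\<Sum>k<Suc m. c k * g ^ k) = c 0 + g * ?S c" for c
    by (simp add: sum.lessThan_Suc_shift sum_distrib_left algebra_simps del: sum.lessThan_Suc)
  have "?S c \<in> R" if "\<And>k. k < Suc m \<Longrightarrow> c k \<in> T" for c
    using that T by (intro unital_subring_sum[OF R] RD unital_subring_power[OF R] g) auto
  then have "?S b - ?S a \<in> R" using Suc.prems by (intro RD) auto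
  moreover have eq: "a 0 - b 0 = g * (?S b - ?S a)"
    using Suc.prems(3) unfolding S by (simp add: algebra_simps)
  ultimately have 0: "a 0 = b 0" using dist Suc.prems by (meson zero_less_Suc)
  then have "?S a = ?S b" using eq g(2) by simp
  then have "\<forall>k<m. a (Suc k) = b (Suc k)" using Suc.prems by (intro Suc.IH) auto
  with 0 show ?case using less_Suc_eq_0_disj by auto
qed auto

text \<open>If \<open>t\<close> exceeded \<open>C\<close>, the powers of \<open>t / C\<close> would
  eventually exceed the constant \<open>E\<close>. The case \<open>m = 1\<close> excludes
  \<open>C = 0\<close>.\<close>

lemma base_le_of_power_le:
  fixes t :: nat
  assumes "\<And>m. t ^ m \<le> E * C ^ m" shows "t \<le> C"
proof (rule ccontr)
  assume "\<not> t \<le> C"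
  then have t: "C + 1 \<le> t" by simp
  have "C \<noteq> 0" using assms[of 1] t by (cases C) auto
  then have "(real t / real C) > 1" using t by auto
  then obtain n where "real E < (real t / real C) ^ n" using real_arch_pow by blast
  then have "real E * real C ^ n < real t ^ n" using \<open>C \<noteq> 0\<close> by (simp add: power_divide field_simps)
  moreover have "real (t ^ n) \<le> real (E * C ^ n)" using assms[of n] of_nat_le_iff by blast
  ultimately show False by simp
qed

text \<open>Uniqueness of digits yields \<open>card T ^ m\<close> different sums, so the growth rate
  bounds the size of the digit set.\<close>

lemma card_le_of_growth:
  assumes R: "unital_subring R" and g: "g \<in> R" "(g :: 'f::field) \<noteq> 0"
    and T: "T \<subseteq> R" "finite T"
    and dist: "\<And>a b r. a \<in> T \<Longrightarrow> b \<in> T \<Longrightarrow> r \<in> R \<Longrightarrow> a - b = g * r \<Longrightarrow> a = b"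
    and growth: "\<And>m. card ((\<lambda>a. \<Sum>k<m. a k * g ^ k) ` ({..<m} \<rightarrow>\<^sub>E T)) \<le> E * C ^ m"
  shows "card T \<le> C"
proof (rule base_le_of_power_le)
  fix m
  have "inj_on (\<lambda>a. \<Sum>k<m. a k * g ^ k) ({..<m} \<rightarrow>\<^sub>E T)"
  proof (rule inj_onI)
    fix a b assume ab: "a \<in> {..<m} \<rightarrow>\<^sub>E T" "b \<in> {..<m} \<rightarrow>\<^sub>E T"
      "(\<Sum>k<m. a k * g ^ k) = (\<Sum>k<m. b k * g ^ k)"
    have "\<forall>k<m. a k = b k"
      by (rule adic_digits_unique[OF R g T(1) dist]) (use ab in auto)
    then show "a = b" using ab(1,2) by (intro PiE_ext) auto
  qed
  then show "card T ^ m \<le> E * C ^ m"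
    using growth[of m] by (simp add: card_image card_PiE)
qed

text \<open>The point is uniformity: one \<open>C\<close>, depending on \<open>g\<close> only,
  bounds the number of residue classes modulo \<open>g\<close> in every subring containing
  \<open>g\<close>. Later finiteness results differ only in the choice of the subring.\<close>

lemma (in finite_field_curve) quotient_bound:
  assumes "(g :: 'f) \<noteq> 0"
  shows "\<exists>C. \<forall>R T. unital_subring R \<longrightarrow> g \<in> R \<longrightarrow> T \<subseteq> R \<longrightarrow> finite T \<longrightarrow>
    (\<forall>a\<in>T. \<forall>b\<in>T. \<forall>r\<in>R. a - b = g * r \<longrightarrow> a = b) \<longrightarrow> card T \<le> C"
proof -
  obtain C where C: "\<And>T. finite T \<Longrightarrow>
    \<exists>E. \<forall>m. card ((\<lambda>a. \<Sum>k<m. a k * g ^ k) ` ({..<m} \<rightarrow>\<^sub>E T)) \<le> E * C ^ m"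
    using growth_bound[of g] by blast
  show ?thesis
  proof (rule exI[of _ C], intro allI impI)
    fix R T :: "'f set"
    assume A: "unital_subring R" "g \<in> R" "T \<subseteq> R" "finite T"
      "\<forall>a\<in>T. \<forall>b\<in>T. \<forall>r\<in>R. a - b = g * r \<longrightarrow> a = b"
    obtain E where "\<forall>m. card ((\<lambda>a. \<Sum>k<m. a k * g ^ k) ` ({..<m} \<rightarrow>\<^sub>E T)) \<le> E * C ^ m"
      using C[OF A(4)] by auto
    then show "card T \<le> C" by (intro card_le_of_growth[OF A(1,2) assms A(3,4)]) (use A(5) in auto)
  qed
qed

section \<open>Points and weak approximation\<close>

text \<open>Treats 0 as having infinite order, which the stored value \<open>v 0 = 0\<close> does
  not express. Thus \<open>ord_ge v k (a - b)\<close> is congruence of \<open>a\<close> and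
  \<open>b\<close> to order \<open>k\<close> at \<open>v\<close>.\<close>

definition ord_ge :: "'f::field point \<Rightarrow> int \<Rightarrow> 'f \<Rightarrow> bool" where
  "ord_ge v k f \<longleftrightarrow> f = 0 \<or> k \<le> v f"

lemma ord_ge_0 [simp]: "ord_ge v k 0"
  by (simp add: ord_ge_def)

lemma ord_ge_mono: "ord_ge v k f \<Longrightarrow> l \<le> k \<Longrightarrow> ord_ge v l f"
  by (auto simp: ord_ge_def)

section \<open>Calculus of orders at a single point\<close>

context
  fixes v :: "'f::field point" and K :: "'f set"
  assumes v: "v \<in> points K"
begin

lemma point_mult: "f \<noteq> 0 \<Longrightarrow> g \<noteq> 0 \<Longrightarrow> v (f * g) = v f + v g"
  using v by (auto simp: points_def)

lemma point_const: "c \<in> K \<Longrightarrow> c \<noteq> 0 \<Longrightarrow> v c = 0"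
  using v by (auto simp: points_def)

lemma point_uniformizer: obtains t where "t \<noteq> 0" "v t = 1"
  using v by (auto simp: points_def)

lemma point_zero: "v 0 = 0"
  using v by (auto simp: points_def)

lemma point_one [simp]: "v 1 = 0"
  using point_mult[of 1 1] by simp

lemma point_uminus: "v (- f) = v f"
proof (cases "f = 0")
  case False
  have "v (-1) = 0" using point_mult[of "-1" "-1"] by simp
  then show ?thesis using point_mult[of "-1" f] False by simp
qed simp

lemma point_inverse: "f \<noteq> 0 \<Longrightarrow> v (inverse f) = - v f"
  using point_mult[of f "inverse f"] by simp

lemma point_divide: "f \<noteq> 0 \<Longrightarrow> g \<noteq> 0 \<Longrightarrow> v (f / g) = v f - v g"
  using point_mult[of f "inverse g"] point_inverse[of g] by (simp add: divide_inverse)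

lemma point_power: "f \<noteq> 0 \<Longrightarrow> v (f ^ n) = int n * v f"
  by (induction n) (auto simp: point_mult algebra_simps)

lemma ord_ge_add: "ord_ge v k f \<Longrightarrow> ord_ge v k g \<Longrightarrow> ord_ge v k (f + g)"
proof -
  assume A: "ord_ge v k f" "ord_ge v k g"
  have "min (v f) (v g) \<le> v (f + g)" if "f \<noteq> 0" "g \<noteq> 0" "f + g \<noteq> 0"
    using v that by (auto simp: points_def)
  then show ?thesis using A unfolding ord_ge_def by fastforce
qed

lemma ord_ge_uminus [simp]: "ord_ge v k (- f) \<longleftrightarrow> ord_ge v k f"
  by (simp add: ord_ge_def point_uminus)

lemma ord_ge_diff: "ord_ge v k f \<Longrightarrow> ord_ge v k g \<Longrightarrow> ord_ge v k (f - g)"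
  using ord_ge_add[of k f "- g"] by simp

lemma ord_ge_mult: "ord_ge v k f \<Longrightarrow> ord_ge v l g \<Longrightarrow> ord_ge v (k + l) (f * g)"
  using point_mult[of f g] by (cases "f = 0 \<or> g = 0") (auto simp: ord_ge_def)

lemma ord_ge_sum: "(\<And>i. i \<in> I \<Longrightarrow> ord_ge v k (f i)) \<Longrightarrow> ord_ge v k (\<Sum>i\<in>I. f i)"
  by (induction I rule: infinite_finite_induct) (auto intro: ord_ge_add)

lemma ord_ge_one: "ord_ge v k 1 \<longleftrightarrow> k \<le> 0"
  by (simp add: ord_ge_def)

text \<open>A larger order of the sum would carry over to \<open>f = (f + g) - g\<close>.\<close>

lemma point_add_dominant:
  assumes "f \<noteq> 0" "g \<noteq> 0" "v f < v g" shows "f + g \<noteq> 0" "v (f + g) = v f"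
proof -
  show nz: "f + g \<noteq> 0" using assms point_uminus[of f] by (metis add_eq_0_iff less_irrefl)
  have "ord_ge v (v f) (f + g)" using assms by (intro ord_ge_add) (auto simp: ord_ge_def)
  moreover have "\<not> v f + 1 \<le> v (f + g)"
  proof
    assume "v f + 1 \<le> v (f + g)"
    then have "ord_ge v (v f + 1) ((f + g) - g)" using assms by (intro ord_ge_diff) (auto simp: ord_ge_def)
    then show False using assms by (simp add: ord_ge_def)
  qed
  ultimately show "v (f + g) = v f" using nz by (auto simp: ord_ge_def)
qed

end

section \<open>Independence of finitely many points\<close>

lemma unital_subring_regular:
  assumes "Z \<subseteq> points K" shows "unital_subring {f :: 'f::field. \<forall>v\<in>Z. ord_ge v 0 f}"
  unfolding unital_subring_def
  using assms ord_ge_mult[of _ K 0 _ 0] ord_ge_diff[of _ K] ord_ge_one[of _ K]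
  by (simp add: subset_iff)

text \<open>Otherwise every function regular at \<open>v\<close> is regular at \<open>w\<close>, and
  units at \<open>v\<close> are units at \<open>w\<close>. Dividing by powers of a uniformizer
  \<open>t\<close> of \<open>v\<close> shows that \<open>w\<close> is \<open>w t\<close> times
  \<open>v\<close>; as \<open>w\<close> takes the value 1, this factor is 1.\<close>

lemma points_incomparable:
  assumes v: "v \<in> points K" and w: "w \<in> points K" and ne: "v \<noteq> w"
  shows "\<exists>f. f \<noteq> 0 \<and> 0 \<le> v f \<and> w f < 0"
proof (rule ccontr)
  assume "\<not> ?thesis"
  then have pos: "\<And>f. f \<noteq> 0 \<Longrightarrow> 0 \<le> v f \<Longrightarrow> 0 \<le> w f" by force
  have unit: "w f = 0" if "f \<noteq> 0" "v f = 0" for f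
    using pos[of f] pos[of "inverse f"] point_inverse[OF v, of f] point_inverse[OF w, of f] that by simp
  obtain t where t: "t \<noteq> 0" "v t = 1" by (rule point_uniformizer[OF v])
  have nonneg: "w f = v f * w t" if "f \<noteq> 0" "0 \<le> v f" for f
  proof -
    have "v (f / t ^ nat (v f)) = 0"
      using that t by (simp add: point_divide[OF v] point_power[OF v])
    then have "w (f / t ^ nat (v f)) = 0" using that t by (intro unit) auto
    then show ?thesis using that t by (simp add: point_divide[OF w] point_power[OF w])
  qed
  have all: "w f = v f * w t" if "f \<noteq> 0" for f
  proof (cases "0 \<le> v f")
    case False
    then show ?thesis using nonneg[of "inverse f"] that by (simp add: point_inverse[OF v] point_inverse[OF w])
  qed (use nonneg that in auto)
  obtain s where s: "s \<noteq> 0" "w s = 1" by (rule point_uniformizer[OF w])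
  have "v s * w t = 1" using all[OF s(1)] s(2) by simp
  moreover have "0 \<le> w t" using pos t by simp
  ultimately have "w t = 1" by (auto simp: zmult_eq_1_iff)
  \<comment> \<open>At \<open>f = 0\<close> equality is due to the convention that both values are
    0.\<close>
  then have "w f = v f" for f
    using all[of f] v w by (cases "f = 0") (auto simp: points_def)
  then show False using ne by auto
qed

lemma points_separate:
  assumes v: "v \<in> points K" and w: "w \<in> points K" and ne: "v \<noteq> w"
  shows "\<exists>f. f \<noteq> 0 \<and> 0 < v f \<and> w f < 0"
proof -
  obtain a b where "a \<noteq> 0" "0 \<le> v a" "w a < 0" "b \<noteq> 0" "0 \<le> w b" "v b < 0"
    using points_incomparable[OF v w] points_incomparable[OF w v] ne by metis
  then show ?thesis
    by (intro exI[of _ "a / b"]) (auto simp: point_divide[OF v] point_divide[OF w])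
qed

text \<open>One point \<open>u\<close> is added at a time. If the function \<open>z\<close> found so
  far has no pole at \<open>u\<close>, a high power of a function separating \<open>v\<close> from
  \<open>u\<close> is added to it.\<close>

lemma point_separate_finite:
  assumes v: "v \<in> points K" and "finite Z" "Z \<subseteq> points K" "v \<notin> Z"
  shows "\<exists>f. f \<noteq> 0 \<and> 0 < v f \<and> (\<forall>w\<in>Z. w f < 0)"
  using assms(2-)
proof (induction Z)
  case empty
  obtain t where "t \<noteq> 0" "v t = 1" by (rule point_uniformizer[OF v])
  then show ?case by (intro exI[of _ t]) auto
next
  case (insert u Z)
  then obtain z where z: "z \<noteq> 0" "0 < v z" "\<forall>w\<in>Z. w z < 0" by auto
  have u: "u \<in> points K" "v \<noteq> u" using insert.prems by auto
  show ?case
  proof (cases "u z < 0")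
    case True
    then show ?thesis using z by auto
  next
    case False
    obtain y where y: "y \<noteq> 0" "0 < v y" "u y < 0" using points_separate[OF v u] by auto
    \<comment> \<open>With \<open>r\<close> beyond all pole orders of \<open>z\<close> on
      \<open>Z\<close>, the orders of \<open>z\<close> and \<open>y ^ Suc r\<close> never tie at a
      point of \<open>Z\<close>: if \<open>w y\<close> is negative the power dominates, otherwise
      \<open>z\<close> does.\<close>
    obtain r where r: "\<forall>w\<in>Z. - w z < int r" 
    proof -
      have "\<exists>r. \<forall>w\<in>Z. - w z < int r"
      proof (rule finite_nat_bound[OF insert.hyps(1)])
        show "\<exists>r. - w z < int r" for w
          by (rule exI[of _ "nat (- w z) + 1"]) linarith
      qed auto
      then show ?thesis using that by auto
    qed
    define f where "f = z + y ^ Suc r"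
    have yr: "y ^ Suc r \<noteq> 0" using y by simp
    have uf: "f \<noteq> 0 \<and> u f < 0"
    proof -
      have "u (y ^ Suc r) < 0" using y u by (simp add: point_power[of u K] mult_pos_neg del: power_Suc)
      then show ?thesis
        using point_add_dominant[OF u(1) yr z(1)] False unfolding f_def by (simp add: add.commute del: power_Suc)
    qed
    have "ord_ge v 1 f" unfolding f_def
      using z y by (intro ord_ge_add[OF v]) (auto simp: ord_ge_def point_power[OF v] zero_less_mult_iff int_one_le_iff_zero_less simp del: power_Suc)
    moreover have "w f < 0" if "w \<in> Z" for w
    proof -
      have w: "w \<in> points K" using insert.prems that by auto
      have wz: "w z < 0" "- w z < int r" using z r that by auto
      have wy: "w (y ^ Suc r) = int (Suc r) * w y" using y by (simp add: point_power[OF w] del: power_Suc)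
      consider "w y < 0" | "0 \<le> w y" by linarith
      then show ?thesis
      proof cases
        case 1
        then have "int (Suc r) * w y \<le> int (Suc r) * (-1)" by (intro mult_left_mono) auto
        then have "w (y ^ Suc r) < w z" using wy wz by simp
        then show ?thesis using point_add_dominant[OF w yr z(1)] wz unfolding f_def by (simp add: add.commute del: power_Suc)
      next
        case 2
        then have "w z < w (y ^ Suc r)" using wz wy by (simp add: order_less_le_trans del: power_Suc)
        then show ?thesis using point_add_dominant[OF w z(1) yr] wz unfolding f_def by simp
      qed
    qed
    ultimately show ?thesis using uf by (intro exI[of _ f]) (auto simp: ord_ge_def)
  qed
qed

text \<open>The function \<open>1 / (1 + y)\<close> is close to 1 where \<open>y\<close> is small
  and close to 0 where \<open>y\<close> has a high pole. A power of a separating function serves as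
  \<open>y\<close>.\<close>

lemma point_indicator:
  assumes v: "v \<in> points K" and Z: "finite Z" "Z \<subseteq> points K" "v \<notin> Z"
  shows "\<exists>e. ord_ge v (int n) (e - 1) \<and> (\<forall>w\<in>Z. ord_ge w (int n) e)"
proof -
  obtain z where z: "z \<noteq> 0" "0 < v z" "\<forall>w\<in>Z. w z < 0" using point_separate_finite[OF assms] by auto
  define y where "y = z ^ Suc n"
  have y0: "y \<noteq> 0" using z by (simp add: y_def)
  have mono: "int n < int (Suc n) * k" if "0 < k" for k :: int
  proof -
    have "int n < int (Suc n) * 1" by simp
    also have "\<dots> \<le> int (Suc n) * k" by (rule mult_left_mono) (use that in auto)
    finally show ?thesis .
  qed
  have vy: "int n < v y" using z mono unfolding y_def by (simp add: point_power[OF v] del: power_Suc)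
  have v1: "1 + y \<noteq> 0" "v (1 + y) = 0" using point_add_dominant[OF v, of 1 y] y0 vy point_one[OF v] by auto
  have "1 / (1 + y) - 1 = - (y / (1 + y))" using v1 by (simp add: field_simps)
  then have "ord_ge v (int n) (1 / (1 + y) - 1)"
    using vy v1 y0 by (simp add: ord_ge_def point_divide[OF v] point_uminus[OF v])
  moreover have "ord_ge w (int n) (1 / (1 + y))" if "w \<in> Z" for w
  proof -
    have w: "w \<in> points K" using that Z by auto
    have "int n < - w y"
      using z that mono[of "- w z"] unfolding y_def by (simp add: point_power[OF w] del: power_Suc)
    moreover from this have "w (1 + y) = w y"
      using point_add_dominant(2)[OF w, of y 1] y0 point_one[OF w] by (simp add: add.commute)
    ultimately show ?thesis using v1 by (simp add: ord_ge_def point_divide[OF w] point_one[OF w])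
  qed
  ultimately show ?thesis by blast
qed

lemma weak_approximation:
  fixes b :: "'f::field point \<Rightarrow> 'f"
  assumes Z: "finite Z" "Z \<subseteq> points K"
  shows "\<exists>a. \<forall>v\<in>Z. ord_ge v (int n) (a - b v)"
proof -
  \<comment> \<open>\<open>M\<close> bounds the pole orders of all targets at all points of
    \<open>Z\<close>. Indicators of precision \<open>n + M\<close> compensate for them, so that the
    sum of \<open>b v * e v\<close> is correct to order \<open>n\<close>.\<close>
  have "\<exists>M. \<forall>p\<in>Z \<times> Z. ord_ge (fst p) (- int M) (b (snd p))"
  proof (rule finite_nat_bound)
    show "\<exists>e. ord_ge (fst p) (- int e) (b (snd p))" for p :: "'f point \<times> 'f point"
      by (rule exI[of _ "nat \<bar>(fst p) (b (snd p))\<bar>"]) (auto simp: ord_ge_def)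
  qed (use Z in \<open>auto elim: ord_ge_mono\<close>)
  then obtain M where M: "\<And>v w. v \<in> Z \<Longrightarrow> w \<in> Z \<Longrightarrow> ord_ge w (- int M) (b v)" by auto
  have "\<exists>e. ord_ge v (int (n + M)) (e - 1) \<and> (\<forall>w\<in>Z - {v}. ord_ge w (int (n + M)) e)" if "v \<in> Z" for v
    using point_indicator[of v K "Z - {v}" "n + M"] that Z by auto
  then obtain e where e: "\<And>v. v \<in> Z \<Longrightarrow> ord_ge v (int (n + M)) (e v - 1)"
    "\<And>v w. v \<in> Z \<Longrightarrow> w \<in> Z \<Longrightarrow> w \<noteq> v \<Longrightarrow> ord_ge w (int (n + M)) (e v)" by (metis DiffI singletonD)
  show ?thesis
  proof (intro exI[of _ "\<Sum>v\<in>Z. b v * e v"] ballI)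
    fix w assume w: "w \<in> Z"
    then have wK: "w \<in> points K" using Z by auto
    have "(\<Sum>v\<in>Z. b v * e v) - b w = b w * (e w - 1) + (\<Sum>v\<in>Z-{w}. b v * e v)"
      using w Z by (simp add: sum.remove algebra_simps)
    moreover have "ord_ge w (- int M + int (n + M)) (b w * (e w - 1))"
      by (rule ord_ge_mult[OF wK M e(1)]) (use w in auto)
    moreover have "ord_ge w (- int M + int (n + M)) (\<Sum>v\<in>Z-{w}. b v * e v)"
      by (intro ord_ge_sum[OF wK] ord_ge_mult[OF wK M e(2)]) (use w in auto)
    ultimately show "ord_ge w (int n) ((\<Sum>v\<in>Z. b v * e v) - b w)"
      using ord_ge_add[OF wK] by simp
  qed
qed

section \<open>Finiteness of zeros, poles and residues\<close>

context finite_field_curve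
begin

text \<open>For a finite set \<open>Z\<close> of zeros of \<open>g\<close>, indicator functions of
  the points of \<open>Z\<close> are regular on \<open>Z\<close> and pairwise incongruent modulo
  \<open>g\<close>. The uniform bound on residue classes therefore limits the number of
  zeros.\<close>

lemma finite_zeros:
  assumes "g \<noteq> 0" shows "finite {v \<in> points K. 0 < v g}"
proof (rule ccontr)
  assume inf: "infinite {v \<in> points K. 0 < v g}"
  obtain C where C: "\<And>R T. unital_subring R \<Longrightarrow> g \<in> R \<Longrightarrow> T \<subseteq> R \<Longrightarrow> finite T \<Longrightarrow>
    (\<forall>a\<in>T. \<forall>b\<in>T. \<forall>r\<in>R. a - b = g * r \<longrightarrow> a = b) \<Longrightarrow> card T \<le> C"
    using quotient_bound[OF assms] by blast
  obtain Z where Z: "finite Z" "card Z = Suc C" "Z \<subseteq> {v \<in> points K. 0 < v g}"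
    using infinite_arbitrarily_large[OF inf] by blast
  then have ZK: "Z \<subseteq> points K" by auto
  have "\<exists>e. ord_ge v (int 1) (e - 1) \<and> (\<forall>w\<in>Z - {v}. ord_ge w (int 1) e)" if "v \<in> Z" for v
    using point_indicator[of v K "Z - {v}" 1] that Z ZK by auto
  then obtain e where e: "\<And>v. v \<in> Z \<Longrightarrow> ord_ge v 1 (e v - 1)"
    "\<And>v w. v \<in> Z \<Longrightarrow> w \<in> Z \<Longrightarrow> w \<noteq> v \<Longrightarrow> ord_ge w 1 (e v)" by (metis DiffI singletonD of_nat_1)
  let ?R = "{f. \<forall>v\<in>Z. ord_ge v 0 f}"
  have R: "unital_subring ?R" by (rule unital_subring_regular[OF ZK])
  have gR: "g \<in> ?R" using Z by (auto simp: ord_ge_def)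
  have eR: "e v \<in> ?R" if "v \<in> Z" for v
  proof -
    have "ord_ge w 0 (e v)" if "w \<in> Z" for w
    proof (cases "w = v")
      case True
      have "ord_ge w 0 ((e w - 1) + 1)"
        using that ZK by (intro ord_ge_add[of w K] ord_ge_mono[OF e(1)]) (auto simp: ord_ge_one)
      then show ?thesis using True by simp
    next
      case False
      then show ?thesis using ord_ge_mono[OF e(2)[OF \<open>v \<in> Z\<close> that]] by auto
    qed
    then show ?thesis by auto
  qed
  have sep: "v = w" if vw: "v \<in> Z" "w \<in> Z" "r \<in> ?R" "e v - e w = g * r" for v w r
  proof (rule ccontr)
    assume "v \<noteq> w"
    have vK: "v \<in> points K" using vw(1) ZK by auto
    have "ord_ge v 1 g" using Z(3) vw(1) by (auto simp: ord_ge_def)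
    then have "ord_ge v (1 + 0) (g * r)" using vw(1,3) by (intro ord_ge_mult[OF vK]) auto
    then have "ord_ge v 1 (e v - e w)" using vw by simp
    then have "ord_ge v 1 ((e v - e w) + e w - (e v - 1))"
      by (rule ord_ge_diff[OF vK ord_ge_add[OF vK _ e(2)] e(1)]) (use vw(1,2) \<open>v \<noteq> w\<close> in auto)
    then show False by (simp add: ord_ge_one[OF vK])
  qed
  have "inj_on e Z" 
  proof (rule inj_onI)
    fix v w assume "v \<in> Z" "w \<in> Z" "e v = e w"
    then show "v = w" using sep[of v w 0] by simp
  qed
  then have "card (e ` Z) = Suc C" using Z card_image by metis
  moreover have "card (e ` Z) \<le> C"
    by (rule C[OF R gR]) (use eR Z sep in blast)+
  ultimately show False by simp
qed

lemma finite_poles: "finite {v \<in> points K. v g < 0}"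
proof (cases "g = 0")
  case True
  then have "{v \<in> points K. v g < 0} = {}" by (auto simp: points_def)
  then show ?thesis by (simp only: finite.emptyI)
next
  case False
  have "{v \<in> points K. v g < 0} = {v \<in> points K. 0 < v (inverse g)}"
    using point_inverse[OF _ False] by fastforce
  then show ?thesis using finite_zeros[of "inverse g"] False by simp
qed

text \<open>Applies the uniform bound to the valuation ring of \<open>v\<close> and a uniformizer,
  since multiples of the uniformizer have order at least 1.\<close>

lemma residues_bounded:
  assumes v: "v \<in> points K"
  shows "\<exists>C. \<forall>T. finite T \<longrightarrow> (\<forall>a\<in>T. ord_ge v 0 a) \<longrightarrow>
    (\<forall>a\<in>T. \<forall>b\<in>T. ord_ge v 1 (a - b) \<longrightarrow> a = b) \<longrightarrow> card T \<le> C"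
proof -
  obtain t where t: "t \<noteq> 0" "v t = 1" by (rule point_uniformizer[OF v])
  obtain C where C: "\<And>R T. unital_subring R \<Longrightarrow> t \<in> R \<Longrightarrow> T \<subseteq> R \<Longrightarrow> finite T \<Longrightarrow>
    (\<forall>a\<in>T. \<forall>b\<in>T. \<forall>r\<in>R. a - b = t * r \<longrightarrow> a = b) \<Longrightarrow> card T \<le> C"
    using quotient_bound[OF t(1)] by blast
  let ?R = "{f. \<forall>w\<in>{v}. ord_ge w 0 f}"
  have R: "unital_subring ?R" by (rule unital_subring_regular[of _ K]) (use v in auto)
  have t1: "ord_ge v 1 t" "ord_ge v 0 t" using t by (auto simp: ord_ge_def)
  show ?thesis
  proof (rule exI[of _ C], intro allI impI)
    fix T assume T: "finite T" "\<forall>a\<in>T. ord_ge v 0 a" "\<forall>a\<in>T. \<forall>b\<in>T. ord_ge v 1 (a - b) \<longrightarrow> a = b"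
    have "ord_ge v 1 (t * r)" if "ord_ge v 0 r" for r
      using ord_ge_mult[OF v t1(1) that] by simp
    then show "card T \<le> C" using T t1 by (intro C[OF R]) auto
  qed
qed

end

section \<open>Residue fields\<close>

text \<open>Coordinates with respect to a basis give a bijection with the lists of length
  \<open>n\<close> over \<open>K\<close>.\<close>

lemma (in ring) card_dimension:
  assumes K: "subfield K R" "finite K" and E: "dimension n K E"
  shows "finite E \<and> card E = card K ^ n"
proof -
  obtain Vs where Vs: "set Vs \<subseteq> carrier R" "independent K Vs" "length Vs = n" "Span K Vs = E"
    using exists_base[OF K(1) E] by blast
  let ?L = "{Ks. set Ks \<subseteq> K \<and> length Ks = n}"
  have "bij_betw (\<lambda>Ks. combine Ks Vs) ?L E"
    unfolding bij_betw_def
  proof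
    show img: "(\<lambda>Ks. combine Ks Vs) ` ?L = E"
      using Span_eq_combine_set_length_version[OF K(1) Vs(1)] Vs(3,4) by auto
    show "inj_on (\<lambda>Ks. combine Ks Vs) ?L"
    proof (rule inj_onI)
      fix Ks Ks' assume A: "Ks \<in> ?L" "Ks' \<in> ?L" "combine Ks Vs = combine Ks' Vs"
      then have "combine Ks Vs \<in> Span K Vs" using img Vs(4) by blast
      from unique_decomposition[OF K(1) Vs(2) this] show "Ks = Ks'" using A Vs(3) by auto
    qed
  qed
  from bij_betw_finite[OF this] bij_betw_same_card[OF this] show ?thesis
    using card_lists_length_eq[OF K(2), of n] finite_lists_length_eq[OF K(2), of n] by simp
qed

context finite_field_curve
begin

text \<open>Replaces the quotient ring in the definition of the point degree by explicit
  representatives. From here on only congruences and the cardinality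
  \<open>card K ^ point_degree K v\<close> are used.\<close>

lemma residue_system:
  assumes v: "v \<in> points K"
  shows "\<exists>T. finite T \<and> card T = card K ^ point_degree K v \<and> (\<forall>a\<in>T. ord_ge v 0 a)
    \<and> (\<forall>u. ord_ge v 0 u \<longrightarrow> (\<exists>a\<in>T. ord_ge v 1 (u - a)))
    \<and> (\<forall>a\<in>T. \<forall>b\<in>T. ord_ge v 1 (a - b) \<longrightarrow> a = b)"
proof -
  interpret F: field "fring :: 'f ring" by (rule field_from_type_algebra)
  let ?O = "Collect (ord_ge v 0)"
  let ?R = "local_ring v" and ?I = "max_ideal v" and ?Q = "residue_field v"
  define h where "h = (\<lambda>c. ?I +>\<^bsub>?R\<^esub> c)"
  have O: "f \<in> ?O \<longleftrightarrow> ord_ge v 0 f" and I: "f \<in> ?I \<longleftrightarrow> ord_ge v 1 f" for f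
    by (auto simp: ord_ge_def max_ideal_def)
  have "{f. f = 0 \<or> 0 \<le> v f} = ?O" by (auto simp: ord_ge_def)
  then have R_eq: "?R = fring\<lparr>carrier := ?O\<rparr>" by (simp add: local_ring_def)
  then have OR: "carrier ?R = ?O" by simp
  have "subring ?O fring"
    using ord_ge_uminus[OF v, of 0] ord_ge_mult[OF v, of 0 _ 0] ord_ge_add[OF v, of 0] ord_ge_one[OF v, of 0]
    by (intro F.subringI) auto
  then have ringR: "ring ?R" unfolding R_eq by (rule F.subring_is_ring)
  interpret R: ring ?R by (rule ringR)
  have opsR: "x \<oplus>\<^bsub>?R\<^esub> y = x + y" "x \<otimes>\<^bsub>?R\<^esub> y = x * y" "\<zero>\<^bsub>?R\<^esub> = 0" "\<one>\<^bsub>?R\<^esub> = 1" for x y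
    by (simp_all add: local_ring_def)
  have negR: "\<ominus>\<^bsub>?R\<^esub> x = - x" if "x \<in> ?O" for x
    using R.minus_equality[of "- x" x] that ord_ge_uminus[OF v] unfolding OR opsR O by auto
  have IO: "?I \<subseteq> ?O" by (auto simp: max_ideal_def ord_ge_def)
  have ideal: "ideal ?I ?R"
  proof (rule idealI[OF ringR])
    show "subgroup ?I (add_monoid ?R)"
    proof (rule R.add.subgroupI)
      show "?I \<subseteq> carrier ?R" using IO OR by simp
      show "?I \<noteq> {}" by (auto simp: max_ideal_def)
      show "\<ominus>\<^bsub>?R\<^esub> a \<in> ?I" if "a \<in> ?I" for a
      proof -
        have "a \<in> ?O" using IO that by blast
        then show ?thesis using that by (simp only: negR I ord_ge_uminus[OF v])
      qed
      show "a \<oplus>\<^bsub>?R\<^esub> b \<in> ?I" if "a \<in> ?I" "b \<in> ?I" for a b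
        using that ord_ge_add[OF v] unfolding opsR I by auto
    qed
    show "x \<otimes>\<^bsub>?R\<^esub> a \<in> ?I" "a \<otimes>\<^bsub>?R\<^esub> x \<in> ?I" if "a \<in> ?I" "x \<in> carrier ?R" for a x
      using that ord_ge_mult[OF v, of 1 a 0 x] unfolding OR opsR O I by (simp_all add: mult.commute)
  qed
  interpret I: ideal ?I ?R by (rule ideal)
  interpret Q: ring_hom_ring ?R ?Q h
    using I.rcos_ring_hom_ring unfolding residue_field_def h_def .
  have h_iff: "h a = h b \<longleftrightarrow> ord_ge v 1 (a - b)" if "ord_ge v 0 a" "ord_ge v 0 b" for a b
  proof
    have hc: "h c = {x + c |x. x \<in> ?I}" for c unfolding h_def a_r_coset_def' by (auto simp: opsR)
    show "ord_ge v 1 (a - b)" if "h a = h b"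
    proof -
      have "a \<in> h b" using that[symmetric] unfolding hc[of a] by (auto simp: I intro: exI[of _ 0])
      then show ?thesis unfolding hc by (auto simp: I)
    qed
    show "h a = h b" if "ord_ge v 1 (a - b)"
    proof -
      have "x + (a - b) \<in> ?I" "x - (a - b) \<in> ?I" if "x \<in> ?I" for x
        using that \<open>ord_ge v 1 (a - b)\<close> ord_ge_add[OF v] ord_ge_diff[OF v] unfolding I by auto
      moreover have "x + a = (x + (a - b)) + b" "x + b = (x - (a - b)) + a" for x by auto
      ultimately show ?thesis unfolding hc by blast
    qed
  qed
  have Qcar: "carrier ?Q = h ` ?O"
    unfolding residue_field_def FactRing_def A_RCOSETS_def' h_def OR[symmetric] by auto
  obtain C where C: "\<And>T. finite T \<Longrightarrow> (\<forall>a\<in>T. ord_ge v 0 a) \<Longrightarrow>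
    (\<forall>a\<in>T. \<forall>b\<in>T. ord_ge v 1 (a - b) \<longrightarrow> a = b) \<Longrightarrow> card T \<le> C"
    using residues_bounded[OF v] by blast
  \<comment> \<open>\<open>T\<close> picks one preimage of each residue class. Its elements are
    pairwise incongruent, so the bound \<open>C\<close> makes it finite.\<close>
  obtain T where T: "T \<subseteq> ?O" "inj_on h T" "h ` T = carrier ?Q"
    using Qcar by (metis subset_image_inj order_refl)
  have Treg: "\<forall>a\<in>T. ord_ge v 0 a" using T(1) by auto
  have Tdist: "\<forall>a\<in>T. \<forall>b\<in>T. ord_ge v 1 (a - b) \<longrightarrow> a = b"
    using Treg h_iff inj_onD[OF T(2)] by metis
  have finT: "finite T"
  proof (rule ccontr)
    assume "infinite T"
    then obtain S where "S \<subseteq> T" "finite S" "card S = Suc C" using infinite_arbitrarily_large by blast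
    then have "card S \<le> C" using Tdist Treg by (intro C) auto
    then show False using \<open>card S = Suc C\<close> by simp
  qed
  have Tcov: "\<exists>a\<in>T. ord_ge v 1 (u - a)" if "ord_ge v 0 u" for u
  proof -
    have "h u \<in> h ` T" using that T(3) Qcar by auto
    then show ?thesis using h_iff that Treg by auto
  qed
  have KO: "K \<subseteq> ?O" using point_const[OF v] by (force simp: ord_ge_def)
  have subK: "subfield K ?R"
    using R.subfield_iff(1)[of K] F.subfield_iff(2)[OF subfield_K] KO OR by (simp add: local_ring_def)
  have ne: "\<one>\<^bsub>?Q\<^esub> \<noteq> \<zero>\<^bsub>?Q\<^esub>"
  proof
    assume "\<one>\<^bsub>?Q\<^esub> = \<zero>\<^bsub>?Q\<^esub>"
    then have "h 1 = h 0" using Q.hom_one Q.hom_zero by (simp add: opsR)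
    then show False using h_iff[of 1 0] by (simp add: ord_ge_one[OF v])
  qed
  have hK: "subfield (h ` K) ?Q" "card (h ` K) = card K"
    using Q.img_is_subfield[OF subK ne] card_image by auto
  have finQ: "finite (carrier ?Q)" "card (carrier ?Q) = card T"
    unfolding T(3)[symmetric] using finT card_image[OF T(2)] by auto
  \<comment> \<open>The finite residue field is spanned by the list of all its elements. This gives
    finite dimension, which ensures that \<open>point_degree\<close> is the actual
    dimension.\<close>
  obtain Us where Us: "set Us = carrier ?Q" using finite_list[OF finQ(1)] by blast
  have "Q.S.Span (h ` K) Us = carrier ?Q"
    using Q.S.Span_base_incl[OF hK(1), of Us] Q.S.Span_subgroup_props(1)[OF hK(1), of Us] Us
    by (metis order_refl subset_antisym)
  then have "Q.S.finite_dimension (h ` K) (carrier ?Q)"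
    using Q.S.Span_finite_dimension[OF hK(1), of Us] Us by (metis order_refl)
  from Q.S.finite_dimensionE[OF hK(1) this]
  have "Q.S.dimension (point_degree K v) (h ` K) (carrier ?Q)"
    unfolding point_degree_def over_def h_def .
  from Q.S.card_dimension[OF hK(1) _ this] have "card T = card K ^ point_degree K v"
    using finite_K hK(2) finQ by simp
  then show ?thesis using finT Treg Tcov Tdist by blast
qed

lemma K_incongruent:
  assumes v: "v \<in> points K" and "a \<in> K" "b \<in> K" "ord_ge v 1 (a - b)" shows "a = b"
  using assms(4) point_const[OF v, of "a - b"] unital_subringD(3)[OF K_subring assms(2,3)]
  by (cases "a = b") (auto simp: ord_ge_def)

text \<open>In degree 0 there would be only one residue class, making 0 and 1 congruent.\<close>

lemma point_degree_pos:
  assumes v: "v \<in> points K" shows "point_degree K v > 0"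
proof (rule ccontr)
  assume "\<not> ?thesis"
  then obtain T where T: "card T = 1" "\<forall>u. ord_ge v 0 u \<longrightarrow> (\<exists>a\<in>T. ord_ge v 1 (u - a))"
    using residue_system[OF v] by auto
  then obtain a where "T = {a}" using card_1_singletonE by blast
  then have "ord_ge v 1 (1 - a)" "ord_ge v 1 (0 - a)"
    using T(2)[rule_format, of 1] T(2)[rule_format, of 0] ord_ge_one[OF v, of 0] by auto
  then have "ord_ge v 1 ((1 - a) - (0 - a))" by (rule ord_ge_diff[OF v])
  then show False by (simp add: ord_ge_one[OF v])
qed

text \<open>Distinct constants are incongruent, and at a rational point there are exactly
  \<open>card K\<close> residue classes. By counting, each class contains a constant.\<close>

lemma rational_residue:
  assumes v: "v \<in> rational_points K" and u: "ord_ge v 0 u"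
  shows "\<exists>c\<in>K. ord_ge v 1 (u - c)"
proof -
  have vK: "v \<in> points K" and deg: "point_degree K v = 1" using v by (auto simp: rational_points_def)
  obtain T where T: "finite T" "card T = card K" "\<And>u. ord_ge v 0 u \<Longrightarrow> \<exists>a\<in>T. ord_ge v 1 (u - a)"
    using residue_system[OF vK] deg by auto
  have K0: "ord_ge v 0 c" if "c \<in> K" for c
    using point_const[OF vK that] by (cases "c = 0") (auto simp: ord_ge_def)
  obtain r where r: "\<And>c. c \<in> K \<Longrightarrow> r c \<in> T \<and> ord_ge v 1 (c - r c)" using T(3)[OF K0] by metis
  have "inj_on r K"
  proof (rule inj_onI)
    fix a b assume "a \<in> K" "b \<in> K" "r a = r b"
    then have "ord_ge v 1 ((a - r a) - (b - r a))" using r by (metis ord_ge_diff[OF vK])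
    then show "a = b" using K_incongruent[OF vK \<open>a \<in> K\<close> \<open>b \<in> K\<close>] by simp
  qed
  then have "r ` K = T" using r T card_image by (intro card_subset_eq) auto
  obtain a where a: "a \<in> T" "ord_ge v 1 (u - a)" using T(3)[OF u] by auto
  then obtain c where c: "c \<in> K" "a = r c" using \<open>r ` K = T\<close> by auto
  have "ord_ge v 1 ((u - a) - (c - a))" using r[OF c(1)] a c by (metis ord_ge_diff[OF vK])
  then show ?thesis using c by auto
qed

end

section \<open>Existence of poles\<close>

definition adjoin :: "'f::field set \<Rightarrow> 'f \<Rightarrow> 'f set" where
  "adjoin R u = {poly p u |p. \<forall>i. Polynomial.coeff p i \<in> R}"

lemma adjoin_subring:
  assumes "unital_subring R" shows "unital_subring (adjoin R u)"
  unfolding unital_subring_def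
proof (intro conjI ballI)
  note R = unital_subringD[OF assms]
  show "1 \<in> adjoin R u"
    unfolding adjoin_def mem_Collect_eq using R(1,2) by (intro exI[of _ 1]) (auto simp: coeff_1)
  fix a b assume "a \<in> adjoin R u" "b \<in> adjoin R u"
  then obtain p q where p: "\<And>i. Polynomial.coeff p i \<in> R" "a = poly p u"
    and q: "\<And>i. Polynomial.coeff q i \<in> R" "b = poly q u" unfolding adjoin_def by blast
  show "a - b \<in> adjoin R u"
    unfolding adjoin_def mem_Collect_eq using R(3) p q by (intro exI[of _ "p - q"]) auto
  show "a * b \<in> adjoin R u"
    unfolding adjoin_def mem_Collect_eq using R(4) p q
    by (intro exI[of _ "p * q"]) (auto simp: coeff_mult intro!: unital_subring_sum[OF assms])
qed

lemma adjoin_incl: "unital_subring R \<Longrightarrow> R \<subseteq> adjoin R u"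
  unfolding adjoin_def
  by (auto intro!: exI[of _ "[:c:]" for c] simp: coeff_pCons unital_subringD split: nat.splits)

lemma adjoin_self: "unital_subring R \<Longrightarrow> u \<in> adjoin R u"
  unfolding adjoin_def
  by (auto intro!: exI[of _ "[:0, 1:]"] simp: coeff_pCons unital_subringD split: nat.splits)

text \<open>HOL-Algebra lists coefficients from the leading one downwards, \<open>coeffs\<close>
  from the constant one upwards; hence the reversal.\<close>

lemma eval_rev_coeffs: "ring.eval fring (rev (coeffs p)) (u :: 'f::field) = poly p u"
proof -
  interpret ring "fring :: 'f ring" by (rule ring_from_type_algebra)
  have pow: "u [^]\<^bsub>fring\<^esub> n = u ^ n" for n :: nat by (induction n) (auto simp: mult.commute)
  have snoc: "eval (xs @ [a]) u = eval xs u * u + a" for xs a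
    by (induction xs) (auto simp: pow algebra_simps)
  show ?thesis by (induction p) (auto simp: snoc cCons_def algebra_simps)
qed

text \<open>A polynomial expression \<open>p\<close> for the inverse of \<open>z\<close> makes
  \<open>z\<close> a root of \<open>X p(X) - 1\<close>. So \<open>z\<close> is algebraic over
  \<open>K\<close>, hence a constant.\<close>

lemma (in finite_field_curve) inverse_in_adjoin_K:
  assumes "inverse z \<in> adjoin K z" shows "z \<in> K"
proof (cases "z = 0")
  case True
  then show ?thesis using unital_subringD(2)[OF K_subring] by simp
next
  case False
  interpret ring "fring :: 'f ring" by (rule ring_from_type_algebra)
  obtain p where p: "\<And>i. Polynomial.coeff p i \<in> K" "inverse z = poly p z"
    using assms unfolding adjoin_def by blast
  define q where "q = pCons (-1) p"
  have q: "q \<noteq> 0" "\<And>i. Polynomial.coeff q i \<in> K" "poly q z = 0"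
    using p False unital_subringD[OF K_subring]
    by (auto simp: q_def coeff_pCons simp flip: p(2) split: nat.splits)
  have "rev (coeffs q) \<in> carrier (K[X]\<^bsub>fring\<^esub>)"
    using q unfolding univ_poly_def polynomial_def
    by (auto simp: hd_rev last_coeffs_eq_coeff_degree coeffs_def)
  then have "(algebraic over K) z"
    by (rule algebraicI) (use q eval_rev_coeffs[of q z] in auto)
  then show ?thesis by (intro full_constants) (simp add: over_def)
qed

text \<open>Zorn's lemma: the union of a nonempty chain of subrings avoiding \<open>x\<close> is
  again such a subring.\<close>

lemma maximal_subring_exists:
  assumes "unital_subring R0" and "x \<notin> R0"
  shows "\<exists>R. unital_subring R \<and> R0 \<subseteq> R \<and> x \<notin> R \<and>
    (\<forall>R'. unital_subring R' \<longrightarrow> R \<subseteq> R' \<longrightarrow> x \<notin> R' \<longrightarrow> R' = R)"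
proof -
  let ?A = "{R. unital_subring R \<and> R0 \<subseteq> R \<and> x \<notin> R}"
  have "\<exists>M\<in>?A. \<forall>Y\<in>?A. M \<subseteq> Y \<longrightarrow> Y = M"
  proof (rule subset_Zorn_nonempty)
    show "?A \<noteq> {}" using assms by auto
    fix Ch assume Ch: "Ch \<noteq> {}" "subset.chain ?A Ch"
    then have mem: "\<And>R. R \<in> Ch \<Longrightarrow> unital_subring R \<and> R0 \<subseteq> R \<and> x \<notin> R"
      and lin: "\<And>R R'. R \<in> Ch \<Longrightarrow> R' \<in> Ch \<Longrightarrow> R \<subseteq> R' \<or> R' \<subseteq> R"
      by (auto simp: subset_chain_def)
    have "unital_subring (\<Union>Ch)"
      unfolding unital_subring_def
    proof (intro conjI ballI)
      show "1 \<in> \<Union>Ch" using Ch(1) mem unital_subringD(1) by blast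
      fix a b assume "a \<in> \<Union>Ch" "b \<in> \<Union>Ch"
      then obtain R where "R \<in> Ch" "a \<in> R" "b \<in> R" using lin by blast
      then show "a - b \<in> \<Union>Ch" "a * b \<in> \<Union>Ch" using mem unital_subringD(3,4) by blast+
    qed
    then show "\<Union>Ch \<in> ?A" using Ch(1) mem by blast
  qed
  then show ?thesis by (smt (verit) mem_Collect_eq order_trans)
qed

text \<open>
  Two relations \<open>1 = z (a\<^sub>0 + \<dots> + a\<^sub>n u\<^sup>n)\<close> and
  \<open>1 = z (b\<^sub>0 + \<dots> + b\<^sub>m u\<^sup>-\<^sup>m)\<close> with \<open>m \<le> n\<close> combine to
  one of degree less than \<open>n\<close> in \<open>u\<close>.
\<close>

lemma maximal_subring_valuation:
  assumes R: "unital_subring R" and z: "z \<in> R" "inverse z \<notin> R"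
    and max: "\<And>R'. unital_subring R' \<Longrightarrow> R \<subseteq> R' \<Longrightarrow> inverse z \<notin> R' \<Longrightarrow> R' = R"
  shows "u \<in> R \<or> inverse u \<in> R"
proof (rule ccontr)
  assume notin: "\<not> (u \<in> R \<or> inverse u \<in> R)"
  note RD = unital_subringD[OF R]
  have z0: "z \<noteq> 0" using z RD(2) by (metis inverse_zero)
  have u0: "u \<noteq> 0" using notin RD(2) by auto
  \<comment> \<open>\<open>W n u\<close> consists of the polynomial expressions in \<open>u\<close>
    of degree at most \<open>n\<close> with coefficients in \<open>z R\<close>. The argument
    concerns representations of 1.\<close>
  define W where "W n u = {(\<Sum>i\<le>n. z * a i * u ^ i) |a. \<forall>i. a i \<in> R}" for n u
  have W_add: "x + y \<in> W n u" if xy: "x \<in> W n u" "y \<in> W n u" for n u x y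
  proof -
    obtain a b where "\<And>i. a i \<in> R" "\<And>i. b i \<in> R" "x = (\<Sum>i\<le>n. z * a i * u ^ i)" "y = (\<Sum>i\<le>n. z * b i * u ^ i)"
      using xy unfolding W_def by blast
    then show ?thesis unfolding W_def mem_Collect_eq using RD(6)
      by (intro exI[of _ "\<lambda>i. a i + b i"]) (auto simp: sum.distrib algebra_simps)
  qed
  have W_mult: "c * x \<in> W n u" if c: "c \<in> R" and x: "x \<in> W n u" for n u x c
  proof -
    obtain a where "\<And>i. a i \<in> R" "x = (\<Sum>i\<le>n. z * a i * u ^ i)" using x unfolding W_def by blast
    then show ?thesis unfolding W_def mem_Collect_eq using RD(4) c
      by (intro exI[of _ "\<lambda>i. c * a i"]) (auto simp: sum_distrib_left algebra_simps)
  qed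
  have W_monom: "z * b * u ^ k \<in> W n u" if "b \<in> R" "k \<le> n" for b k n u
    unfolding W_def mem_Collect_eq using that RD(2)
    by (intro exI[of _ "\<lambda>i. if i = k then b else 0"])
      (auto simp: if_distrib[of "\<lambda>x. z * x * _"] cong: if_cong)
  have W_0: "0 \<in> W n u" for n u using W_monom[of 0 0 n u] RD(2) by simp
  have W_sum: "(\<Sum>i\<in>I. f i) \<in> W n u" if "\<And>i. i \<in> I \<Longrightarrow> f i \<in> W n u" for I :: "nat set" and f n u
    using that by (induction I rule: infinite_finite_induct) (auto intro: W_0 W_add)
  have no0: "1 \<notin> W 0 u" for u
  proof
    assume "1 \<in> W 0 u"
    then obtain a where "a \<in> R" "1 = z * a" unfolding W_def by auto
    then show False using z z0 by (metis inverse_unique)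
  qed
  have shrink: "1 \<in> W (n - 1) u" if A: "1 \<in> W n u" "1 \<in> W m (inverse u)" "m \<le> n" "u \<noteq> 0" for n m u
  proof -
    obtain l where l: "n = Suc l" using A(1) no0 by (cases n) auto
    obtain a where a: "\<And>i. a i \<in> R" "1 = (\<Sum>i\<le>n. z * a i * u ^ i)" using A(1) unfolding W_def by blast
    obtain b where b: "\<And>i. b i \<in> R" "1 = (\<Sum>i\<le>m. z * b i * inverse u ^ i)" using A(2) unfolding W_def by blast
    have "u ^ n = u ^ n * (\<Sum>i\<le>m. z * b i * inverse u ^ i)" using b(2) by simp
    also have "\<dots> = (\<Sum>i\<le>m. z * b i * u ^ (n - i))"
      unfolding sum_distrib_left
    proof (intro sum.cong refl)
      fix i assume "i \<in> {..m}"
      then have "u ^ n = u ^ (n - i) * u ^ i" using A(3) by (simp flip: power_add)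
      then show "u ^ n * (z * b i * inverse u ^ i) = z * b i * u ^ (n - i)"
        using A(4) by (simp add: power_inverse)
    qed
    also have "\<dots> = z * b 0 * u ^ n + (\<Sum>i\<in>{1..m}. z * b i * u ^ (n - i))"
      by (simp add: sum.atMost_shift sum.atLeast1_atMost_eq)
    \<comment> \<open>Multiplied by \<open>u ^ n\<close>, the relation in the inverse of
      \<open>u\<close> expresses this multiple of \<open>u ^ n\<close> by lower powers. It then
      eliminates the top term of the other relation multiplied by
      \<open>1 - z * b 0\<close>.\<close>
    finally have un: "(1 - z * b 0) * u ^ n = (\<Sum>i\<in>{1..m}. z * b i * u ^ (n - i))"
      by (simp add: algebra_simps)
    let ?s = "\<Sum>i\<le>l. z * a i * u ^ i" and ?t = "\<Sum>i\<in>{1..m}. z * b i * u ^ (n - i)"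
    have a1: "1 = ?s + z * a n * u ^ n" using a(2) l by simp
    have "1 = z * b 0 + (1 - z * b 0) * 1" by simp
    also have "\<dots> = z * b 0 + (1 - z * b 0) * (?s + z * a n * u ^ n)" using a1 by simp
    also have "\<dots> = z * b 0 * u ^ 0 + ((1 - z * b 0) * ?s + z * a n * ?t)"
      unfolding un[symmetric] by (simp add: algebra_simps)
    also have "\<dots> \<in> W l u"
    proof (rule W_add[OF W_monom W_add[OF W_mult[OF _ W_sum] W_mult[OF _ W_sum]]])
      show "1 - z * b 0 \<in> R" "z * a n \<in> R" using RD a b z by auto
    qed (use a(1) b(1) l in \<open>auto intro!: W_monom\<close>)
    finally show ?thesis using l by simp
  qed
  \<comment> \<open>Descent on \<open>n + m\<close>; if \<open>m\<close> is the larger degree,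
    \<open>u\<close> and its inverse exchange roles. Degree 0 is impossible because it would put the
    inverse of \<open>z\<close> into \<open>R\<close>.\<close>
  have none: "\<not> (1 \<in> W n u \<and> 1 \<in> W m (inverse u))" if "u \<noteq> 0" for n m u
    using that
  proof (induction "n + m" arbitrary: n m u rule: less_induct)
    case less
    show ?case
    proof
      assume A: "1 \<in> W n u \<and> 1 \<in> W m (inverse u)"
      then have pos: "n > 0" "m > 0" using no0 by (metis gr0I)+
      show False
      proof (cases "m \<le> n")
        case True
        then have "1 \<in> W (n - 1) u" using shrink A less.prems by blast
        then show False using less.hyps[of "n - 1" m u] A pos less.prems by auto
      next
        case False
        then have "1 \<in> W (m - 1) (inverse u)"
          using shrink[of m "inverse u" n] A less.prems by auto
        then show False using less.hyps[of n "m - 1" u] A pos less.prems by auto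
      qed
    qed
  qed
  \<comment> \<open>By maximality the ring obtained by adjoining \<open>u\<close> contains the
    inverse of \<open>z\<close>. Multiplying such an expression by \<open>z\<close> represents
    1.\<close>
  have ex: "\<exists>n. 1 \<in> W n u" if "u \<notin> R" for u
  proof -
    have "inverse z \<in> adjoin R u"
      using max[OF adjoin_subring[OF R] adjoin_incl[OF R]] adjoin_self[OF R] that by blast
    then obtain p where p: "\<And>i. Polynomial.coeff p i \<in> R" "inverse z = poly p u"
      unfolding adjoin_def by blast
    have "1 = z * poly p u" using p(2) z0 by (metis right_inverse)
    also have "\<dots> = (\<Sum>i\<le>Polynomial.degree p. z * Polynomial.coeff p i * u ^ i)"
      by (simp add: poly_altdef sum_distrib_left mult.assoc)
    finally show ?thesis using p(1) unfolding W_def by blast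
  qed
  show False using ex[of u] ex[of "inverse u"] none[OF u0] notin by blast
qed

section \<open>Valuation rings and their maximal ideals\<close>

locale valuation_subring =
  fixes V :: "'f::field set"
  assumes subring_V: "unital_subring V" and valuation: "u \<in> V \<or> inverse u \<in> V"
begin

lemmas V = unital_subringD[OF subring_V]

text \<open>Membership in the maximal ideal of \<open>V\<close>. Zero is listed separately since
  \<open>inverse 0 = 0\<close> lies in \<open>V\<close>.\<close>

definition nonunit :: "'f \<Rightarrow> bool" where
  "nonunit x \<longleftrightarrow> x \<in> V \<and> (x = 0 \<or> inverse x \<notin> V)"

lemma nonunit_mult: "r \<in> V \<Longrightarrow> nonunit x \<Longrightarrow> nonunit (r * x)"
proof -
  assume A: "r \<in> V" "nonunit x"
  have "inverse x = r * inverse (r * x)" if "r * x \<noteq> 0" using that by auto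
  then show ?thesis using A V(4) unfolding nonunit_def by (metis mult_eq_0_iff)
qed

text \<open>One of \<open>x / y\<close> and \<open>y / x\<close> lies in \<open>V\<close>, so the
  sum is a multiple of one of the two summands.\<close>

lemma nonunit_add: "nonunit x \<Longrightarrow> nonunit y \<Longrightarrow> nonunit (x + y)"
proof -
  assume A: "nonunit x" "nonunit y"
  consider "x = 0 \<or> y = 0" | "x \<noteq> 0" "y \<noteq> 0" "x / y \<in> V" | "x \<noteq> 0" "y \<noteq> 0" "y / x \<in> V"
    using valuation[of "x / y"] by auto
  then show ?thesis
  proof cases
    case 2
    have "x + y = (x / y + 1) * y" using 2 by (simp add: field_simps)
    then show ?thesis using 2 A V by (metis nonunit_mult)
  next
    case 3
    have "x + y = (1 + y / x) * x" using 3 by (simp add: field_simps)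
    then show ?thesis using 3 A V by (metis nonunit_mult)
  qed (use A in auto)
qed

lemma nonunit_diff: "nonunit x \<Longrightarrow> nonunit y \<Longrightarrow> nonunit (x - y)"
  using nonunit_add[of x "-1 * y"] nonunit_mult[of "-1" y] V(1,5) by simp

lemma not_nonunit_one: "\<not> nonunit 1"
  using V(1) by (simp add: nonunit_def)

text \<open>Divisibility in a valuation ring is a total preorder, so a finite set of nonzero
  elements has a member dividing all others.\<close>

lemma finite_common_divisor:
  assumes "finite M" "M \<noteq> {}" "0 \<notin> M"
  shows "\<exists>t\<in>M. \<forall>a\<in>M. a / t \<in> V"
  using assms
proof (induction M rule: finite_ne_induct)
  case (singleton x)
  then show ?case using V(1) by simp
next
  case (insert x M)
  then obtain t where t: "t \<in> M" "\<forall>a\<in>M. a / t \<in> V" by auto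
  have nz: "t \<noteq> 0" "x \<noteq> 0" using insert.prems t by auto
  show ?case
  proof (cases "x / t \<in> V")
    case True
    then show ?thesis using t by auto
  next
    case False
    then have tx: "t / x \<in> V" using valuation[of "x / t"] by simp
    have "a / x \<in> V" if "a \<in> M" for a
    proof -
      have "a / x = (a / t) * (t / x)" using nz by simp
      then show ?thesis using t(2) tx that V(4) by metis
    qed
    then show ?thesis using V(1) nz by auto
  qed
qed

text \<open>Since \<open>V\<close> has finitely many classes modulo \<open>z\<close>, the maximal
  ideal is generated by \<open>z\<close> and finitely many representatives. A common divisor among
  these generates it alone.\<close>

lemma maximal_ideal_principal:
  assumes z: "nonunit z" "z \<noteq> 0"
    and fin: "\<And>T. T \<subseteq> V \<Longrightarrow> finite T \<Longrightarrow> (\<forall>a\<in>T. \<forall>b\<in>T. \<forall>r\<in>V. a - b = z * r \<longrightarrow> a = b) \<Longrightarrow> card T \<le> C"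
  shows "\<exists>t. nonunit t \<and> t \<noteq> 0 \<and> (\<forall>w. nonunit w \<longrightarrow> w / t \<in> V)"
proof -
  define P where "P T \<longleftrightarrow> T \<subseteq> V \<and> finite T \<and> (\<forall>a\<in>T. \<forall>b\<in>T. \<forall>r\<in>V. a - b = z * r \<longrightarrow> a = b)" for T
  have "P {}" by (simp add: P_def)
  moreover have "\<forall>T. P T \<longrightarrow> card T < Suc C" using fin by (simp add: P_def le_imp_less_Suc)
  \<comment> \<open>An incongruent set of greatest size represents every class, since otherwise a
    further element could be inserted.\<close>
  ultimately obtain T where T: "P T" "\<And>T'. P T' \<Longrightarrow> card T' \<le> card T"
    using ex_has_greatest_nat[of P "{}" card "Suc C"] by metis
  have TV: "T \<subseteq> V" "finite T" "\<And>a b r. a \<in> T \<Longrightarrow> b \<in> T \<Longrightarrow> r \<in> V \<Longrightarrow> a - b = z * r \<Longrightarrow> a = b"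
    using T(1) unfolding P_def by blast+
  have cover: "\<exists>a\<in>T. \<exists>r\<in>V. w - a = z * r" if w: "w \<in> V" for w
  proof (rule ccontr)
    assume no: "\<not> ?thesis"
    then have "w \<notin> T" using V(2) by force
    have no': "a - w \<noteq> z * r" if "a \<in> T" "r \<in> V" for a r
      using no that V(5)[of r] by (metis minus_diff_eq mult_minus_right)
    have "P (insert w T)"
      unfolding P_def
    proof (intro conjI ballI impI)
      fix a b r assume "a \<in> insert w T" "b \<in> insert w T" "r \<in> V" "a - b = z * r"
      then show "a = b" using TV(3)[of a b r] no no' by blast
    qed (use TV w in auto)
    from T(2)[OF this] show False using TV(2) \<open>w \<notin> T\<close> by simp
  qed
  let ?M = "insert z {a \<in> T. a \<noteq> 0 \<and> nonunit a}"
  have "\<exists>t\<in>?M. \<forall>a\<in>?M. a / t \<in> V" by (rule finite_common_divisor) (use TV(2) z in auto)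
  then obtain t where t: "t \<in> ?M" "\<And>a. a \<in> ?M \<Longrightarrow> a / t \<in> V" by blast
  have "w / t \<in> V" if "nonunit w" for w
  proof -
    obtain a r where a: "a \<in> T" "r \<in> V" "w - a = z * r"
      using cover[of w] \<open>nonunit w\<close> unfolding nonunit_def by blast
    have "a = w - r * z" using a(3) by (simp add: algebra_simps)
    then have "nonunit a" using that nonunit_diff nonunit_mult[OF a(2) z(1)] by simp
    then have "a / t \<in> V" using a(1) t(2) V(2) by (cases "a = 0") auto
    moreover have "w / t = a / t + (z / t) * r" using a(3) by (simp add: field_simps flip: add_divide_distrib)
    moreover have "(z / t) * r \<in> V" using t(2)[of z] a(2) V(4) by blast
    ultimately show ?thesis using V(6) by metis
  qed
  then show ?thesis using t(1) z by auto
qed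

end

text \<open>The element \<open>t\<close> generates the maximal ideal, and no nonzero element of
  \<open>V\<close> is divisible by all powers of \<open>t\<close>. Together these give every nonzero
  element a unique exponent of \<open>t\<close>.\<close>

locale discrete_valuation_subring = valuation_subring V for V :: "'f::field set" +
  fixes t :: 'f
  assumes nonunit_t: "nonunit t" and t_nz: "t \<noteq> 0"
    and generates: "nonunit w \<Longrightarrow> w / t \<in> V"
    and separated: "w \<in> V \<Longrightarrow> w \<noteq> 0 \<Longrightarrow> \<exists>k. w / t ^ k \<notin> V"
begin

definition unit :: "'f \<Rightarrow> bool" where
  "unit u \<longleftrightarrow> u \<noteq> 0 \<and> u \<in> V \<and> inverse u \<in> V"

lemma unit_mult: "unit a \<Longrightarrow> unit b \<Longrightarrow> unit (a * b)"
  using V(4) by (auto simp: unit_def)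

lemma unit_inverse: "unit a \<Longrightarrow> unit (inverse a)"
  by (auto simp: unit_def)

lemma power_nonunit: "n > 0 \<Longrightarrow> nonunit (t ^ n)"
proof (cases n)
  case (Suc m)
  have "t ^ m \<in> V" using nonunit_t unital_subring_power[OF subring_V] by (simp add: nonunit_def)
  from nonunit_mult[OF this nonunit_t] show ?thesis by (simp add: Suc mult.commute)
qed simp

lemma powi_unit:
  assumes "unit (t powi k)" shows "k = 0"
proof (rule ccontr)
  assume "k \<noteq> 0"
  have "\<not> unit (t ^ n)" if "n > 0" for n
    using power_nonunit[OF that] by (auto simp: unit_def nonunit_def)
  moreover have "unit (t ^ nat \<bar>k\<bar>)"
    using assms unit_inverse[OF assms] by (cases "k \<ge> 0") (auto simp: power_int_def power_inverse)
  ultimately show False using \<open>k \<noteq> 0\<close> by simp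
qed

text \<open>For \<open>f\<close> in \<open>V\<close>, divide by the highest power of
  \<open>t\<close> that keeps the quotient in \<open>V\<close>. The quotient is a unit, since from a
  nonunit another \<open>t\<close> could be split off. Otherwise the inverse of \<open>f\<close>
  lies in \<open>V\<close>.\<close>

lemma ex_decomposition:
  assumes "f \<noteq> 0" shows "\<exists>k. unit (f / t powi k)"
proof -
  have *: "\<exists>j. unit (f / t ^ j)" if f: "f \<in> V" "f \<noteq> 0" for f
  proof -
    let ?k = "LEAST k. f / t ^ k \<notin> V"
    have k: "f / t ^ ?k \<notin> V" using separated[OF f] by (rule LeastI_ex)
    then obtain j where j: "?k = Suc j" using f by (cases ?k) auto
    then have u: "f / t ^ j \<in> V" using not_less_Least[of j "\<lambda>k. f / t ^ k \<notin> V"] by auto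
    have "\<not> nonunit (f / t ^ j)" using k j generates[of "f / t ^ j"] by (auto simp: mult.commute)
    then show ?thesis using u f t_nz by (auto simp: unit_def nonunit_def)
  qed
  show ?thesis
  proof (cases "f \<in> V")
    case True
    then obtain j where "unit (f / t ^ j)" using * assms by blast
    then show ?thesis by (intro exI[of _ "int j"]) simp
  next
    case False
    then have "inverse f \<in> V" "inverse f \<noteq> 0" using valuation[of f] assms by auto
    then obtain j where "unit (inverse f / t ^ j)" using * by blast
    from unit_inverse[OF this] show ?thesis
      by (intro exI[of _ "- int j"]) (simp add: power_int_minus field_simps)
  qed
qed

definition val :: "'f \<Rightarrow> int" where
  "val f = (if f = 0 then 0 else (THE k. unit (f / t powi k)))"

lemma val_eqI:
  assumes "f \<noteq> 0" "unit (f / t powi k)" shows "val f = k"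
proof -
  have "l = k" if "unit (f / t powi l)" for l
  proof -
    have "(f / t powi k) * inverse (f / t powi l) = t powi (l - k)"
      using assms(1) t_nz by (simp add: power_int_diff field_simps)
    then have "unit (t powi (l - k))" using assms(2) that unit_mult unit_inverse by metis
    then show ?thesis using powi_unit by fastforce
  qed
  with assms(2) have "(THE k. unit (f / t powi k)) = k" by (rule the_equality)
  then show ?thesis using assms(1) by (simp add: val_def)
qed

lemma val_unit: "f \<noteq> 0 \<Longrightarrow> unit (f / t powi (val f))"
proof -
  assume "f \<noteq> 0"
  then obtain k where "unit (f / t powi k)" using ex_decomposition by blast
  then show ?thesis using val_eqI[OF \<open>f \<noteq> 0\<close>] by simp
qed

lemma val_mult: assumes "f \<noteq> 0" "g \<noteq> 0" shows "val (f * g) = val f + val g"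
proof (rule val_eqI)
  have "f * g / t powi (val f + val g) = (f / t powi val f) * (g / t powi val g)"
    using t_nz by (simp add: power_int_add)
  then show "unit (f * g / t powi (val f + val g))" using assms val_unit unit_mult by metis
qed (use assms in auto)

lemma val_powi: "val (t powi k) = k"
  using t_nz V(1) by (intro val_eqI) (auto simp: unit_def)

lemma val_pos: assumes "nonunit h" "h \<noteq> 0" shows "val h > 0"
proof (rule ccontr)
  assume "\<not> ?thesis"
  then have "h / t powi (val h) = t ^ nat (- val h) * h"
    by (simp add: power_int_def field_simps)
  moreover have "t ^ nat (- val h) \<in> V"
    using unital_subring_power[OF subring_V] nonunit_t by (simp add: nonunit_def)
  ultimately have "nonunit (h / t powi (val h))" using nonunit_mult assms(1) by metis
  then show False using val_unit[OF assms(2)] by (auto simp: unit_def nonunit_def)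
qed

lemma val_nonneg: assumes "h \<in> V" "h \<noteq> 0" shows "val h \<ge> 0"
proof (cases "nonunit h")
  case True
  then show ?thesis using val_pos assms by force
next
  case False
  then have "val h = 0" using assms by (intro val_eqI) (auto simp: unit_def nonunit_def)
  then show ?thesis by simp
qed

lemma val_add_aux:
  assumes "f \<noteq> 0" "g \<noteq> 0" "f + g \<noteq> 0" "val f \<le> val g" shows "val f \<le> val (f + g)"
proof -
  let ?k = "val f"
  have "t powi (val g) = t ^ nat (val g - ?k) * t powi ?k"
    using t_nz assms(4) power_int_add[of t "val g - ?k" ?k] by (simp add: power_int_def)
  then have "(f + g) / t powi ?k = f / t powi ?k + (g / t powi (val g)) * t ^ nat (val g - ?k)"
    using t_nz by (simp add: field_simps)
  moreover have "t ^ n \<in> V" for n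
    using nonunit_t unital_subring_power[OF subring_V] by (simp add: nonunit_def)
  moreover have "f / t powi ?k \<in> V" "g / t powi (val g) \<in> V"
    using val_unit[OF assms(1)] val_unit[OF assms(2)] by (auto simp only: unit_def)
  ultimately have "(f + g) / t powi ?k \<in> V" using V(4,6) by metis
  then have "0 \<le> val ((f + g) / t powi ?k)" using assms t_nz by (intro val_nonneg) auto
  moreover have "val (f + g) = val ((f + g) / t powi ?k) + ?k"
    using val_mult[of "(f + g) / t powi ?k" "t powi ?k"] assms t_nz val_powi by simp
  ultimately show ?thesis by simp
qed

lemma val_point:
  assumes "K \<subseteq> V" "\<And>c. c \<in> K \<Longrightarrow> inverse c \<in> K"
  shows "val \<in> points K"
  unfolding points_def mem_Collect_eq
proof (intro conjI allI impI ballI)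
  show "val 0 = 0" by (simp add: val_def)
  show "\<exists>x. x \<noteq> 0 \<and> val x = 1" using t_nz val_powi[of 1] by auto
  show "val (f * g) = val f + val g" if "f \<noteq> 0 \<and> g \<noteq> 0" for f g using val_mult that by auto
  show "min (val f) (val g) \<le> val (f + g)" if "f \<noteq> 0 \<and> g \<noteq> 0 \<and> f + g \<noteq> 0" for f g
    using val_add_aux[of f g] val_add_aux[of g f] that
    by (cases "val f \<le> val g") (auto simp: add.commute)
  show "val c = 0" if "c \<in> K" "c \<noteq> 0" for c
    using that assms by (intro val_eqI) (auto simp: unit_def)
qed

end

section \<open>Points obtained from maximal subrings\<close>

context finite_field_curve
begin

text \<open>If all powers of \<open>t\<close> divided \<open>w\<close>, the powers of
  \<open>t\<close> would be pairwise incongruent modulo \<open>w\<close> in the localization of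
  \<open>V\<close> at \<open>t\<close>. This contradicts the bound on residue classes modulo
  \<open>w\<close>.\<close>

lemma valuation_subring_separated:
  assumes "valuation_subring V" and t: "valuation_subring.nonunit V t" "t \<noteq> 0"
    and w: "(w :: 'f) \<noteq> 0"
  shows "\<exists>k. w / t ^ k \<notin> V"
proof (rule ccontr)
  interpret valuation_subring V by fact
  assume "\<not> ?thesis"
  then have wt: "\<And>k. w / t ^ k \<in> V" by simp
  obtain C where C: "\<And>R T. unital_subring R \<Longrightarrow> w \<in> R \<Longrightarrow> T \<subseteq> R \<Longrightarrow> finite T \<Longrightarrow>
    (\<forall>a\<in>T. \<forall>b\<in>T. \<forall>r\<in>R. a - b = w * r \<longrightarrow> a = b) \<Longrightarrow> card T \<le> C"
    using quotient_bound[OF w] by blast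
  have tV: "t ^ k \<in> V" for k using t unital_subring_power[OF subring_V] by (simp add: nonunit_def)
  let ?R = "{a. \<exists>k. a * t ^ k \<in> V}"
  have R: "unital_subring ?R"
    unfolding unital_subring_def
  proof (intro conjI ballI)
    show "1 \<in> ?R" using V(1) by (auto intro: exI[of _ 0])
    fix a b assume "a \<in> ?R" "b \<in> ?R"
    then obtain k l where kl: "a * t ^ k \<in> V" "b * t ^ l \<in> V" by auto
    have "(a - b) * t ^ (k + l) = (a * t ^ k) * t ^ l - (b * t ^ l) * t ^ k"
      "(a * b) * t ^ (k + l) = (a * t ^ k) * (b * t ^ l)"
      by (auto simp: power_add algebra_simps)
    then have "(a - b) * t ^ (k + l) \<in> V" "(a * b) * t ^ (k + l) \<in> V"
      using kl tV V(3,4) by metis+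
    then show "a - b \<in> ?R" "a * b \<in> ?R" by blast+
  qed
  have less: "i = j" if eq: "t ^ i - t ^ j = w * r" and k: "r * t ^ k \<in> V" and "i \<le> j" for i j r k
  proof (rule ccontr)
    assume "i \<noteq> j"
    then obtain d where d: "j = i + Suc d" using \<open>i \<le> j\<close> less_imp_Suc_add[of i j] by auto
    \<comment> \<open>As \<open>t ^ Suc d\<close> is a nonunit, \<open>1 - t ^ Suc d\<close> is a
      unit, so \<open>w\<close> would divide \<open>t ^ i\<close> in the localization. The excess
      divisibility of \<open>w\<close> by \<open>t\<close> then exhibits 1 as a nonunit.\<close>
    have "nonunit (t ^ Suc d)" using nonunit_mult[OF tV t(1), of d] by (simp add: mult.commute)
    then have "\<not> nonunit (1 - t ^ Suc d)"
      using nonunit_add[of "1 - t ^ Suc d" "t ^ Suc d"] not_nonunit_one by auto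
    then have u: "inverse (1 - t ^ Suc d) \<in> V" "1 - t ^ Suc d \<noteq> 0"
      using V(1,3) tV by (auto simp: nonunit_def simp del: power_Suc)
    have "t ^ i * (1 - t ^ Suc d) = w * r" using eq d by (simp add: power_add algebra_simps)
    then have "t ^ i = w * r * inverse (1 - t ^ Suc d)" using u(2) by (simp add: field_simps)
    moreover have shift: "x * t ^ (i + k + 1) = x * t * t ^ (i + k)" for x by simp
    ultimately have "t ^ (i + k) = w * r * inverse (1 - t ^ Suc d) * t ^ k" by (simp only: power_add)
    also have "\<dots> = (w / t ^ (i + k + 1)) * (r * t ^ k) * inverse (1 - t ^ Suc d) * t ^ (i + k + 1)"
      using t(2) by (simp del: power_Suc)
    also have "\<dots> = (w / t ^ (i + k + 1)) * (r * t ^ k) * inverse (1 - t ^ Suc d) * t * t ^ (i + k)"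
      by (rule shift)
    finally have "1 = (w / t ^ (i + k + 1)) * (r * t ^ k) * inverse (1 - t ^ Suc d) * t"
      using t(2) by (metis mult_cancel_right mult_1 power_not_zero)
    moreover have "(w / t ^ (i + k + 1)) * (r * t ^ k) * inverse (1 - t ^ Suc d) \<in> V"
      using wt[of "i + k + 1"] k u(1) V(4) by blast
    ultimately show False using nonunit_mult[OF _ t(1)] not_nonunit_one by metis
  qed
  have sep: "i = j" if eq: "t ^ i - t ^ j = w * r" and r: "r \<in> ?R" for i j r
  proof (cases "i \<le> j")
    case True
    then show ?thesis using less[OF eq] r by auto
  next
    case False
    obtain k where "r * t ^ k \<in> V" using r by auto
    then have "(- r) * t ^ k \<in> V" using V(5) by fastforce
    moreover have "t ^ j - t ^ i = w * (- r)" using eq by (simp add: algebra_simps)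
    ultimately show ?thesis using less[of j i "- r" k] False by auto
  qed
  let ?T = "(\<lambda>i. t ^ i) ` {..C}"
  have "inj_on (\<lambda>i. t ^ i) {..C}"
  proof (rule inj_onI)
    fix i j assume "t ^ i = t ^ j"
    then show "i = j" using sep[of i j 0] V(2) by auto
  qed
  then have "card ?T = Suc C" by (simp add: card_image)
  moreover have "card ?T \<le> C"
  proof (rule C[OF R])
    show "w \<in> ?R" using wt[of 0] by (auto intro!: exI[of _ 0])
    show "?T \<subseteq> ?R" using tV by (auto intro!: exI[of _ 0])
    show "\<forall>a\<in>?T. \<forall>b\<in>?T. \<forall>r\<in>?R. a - b = w * r \<longrightarrow> a = b" using sep by blast
  qed simp
  ultimately show False by simp
qed

text \<open>A subring containing \<open>K\<close> and \<open>z = inverse g\<close>, maximal among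
  those omitting \<open>g\<close>, is a discrete valuation ring with \<open>z\<close> as a nonunit.
  Its valuation is positive at \<open>z\<close>, hence negative at \<open>g\<close>.\<close>

lemma ex_pole:
  assumes "g \<notin> K" shows "\<exists>v\<in>points K. v g < 0"
proof -
  define z where "z = inverse g"
  have g0: "g \<noteq> 0" using assms unital_subringD(2)[OF K_subring] by auto
  have z: "z \<noteq> 0" "z \<notin> K" "inverse z = g"
    using g0 assms K_inverse[of z] by (auto simp: z_def)
  then have "inverse z \<notin> adjoin K z" using inverse_in_adjoin_K by blast
  from maximal_subring_exists[OF adjoin_subring[OF K_subring] this] obtain V where
    W: "unital_subring V" "adjoin K z \<subseteq> V" "inverse z \<notin> V"
    "\<And>R. unital_subring R \<Longrightarrow> V \<subseteq> R \<Longrightarrow> inverse z \<notin> R \<Longrightarrow> R = V" by blast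
  have zV: "z \<in> V" "K \<subseteq> V" using W(2) adjoin_self[OF K_subring] adjoin_incl[OF K_subring] by blast+
  interpret valuation_subring V
    by unfold_locales (use W(1) maximal_subring_valuation[OF W(1) zV(1) W(3,4)] in auto)
  have nz: "nonunit z" using zV W(3) by (simp add: nonunit_def)
  obtain C where C: "\<And>R T. unital_subring R \<Longrightarrow> z \<in> R \<Longrightarrow> T \<subseteq> R \<Longrightarrow> finite T \<Longrightarrow>
    (\<forall>a\<in>T. \<forall>b\<in>T. \<forall>r\<in>R. a - b = z * r \<longrightarrow> a = b) \<Longrightarrow> card T \<le> C"
    using quotient_bound[OF z(1)] by blast
  obtain t where t: "nonunit t" "t \<noteq> 0" "\<And>w. nonunit w \<Longrightarrow> w / t \<in> V"
    using maximal_ideal_principal[OF nz z(1) C[OF W(1) zV(1)]] by blast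
  interpret discrete_valuation_subring V t
    using t valuation_subring_separated[OF valuation_subring_axioms t(1,2)] by unfold_locales auto
  have "val \<in> points K" by (rule val_point[OF zV(2) K_inverse])
  moreover have "val g < 0"
    using val_pos[OF nz z(1)] point_inverse[OF \<open>val \<in> points K\<close> z(1)] z(3) by simp
  ultimately show ?thesis by blast
qed

end

section \<open>Riemann-Roch spaces and degrees\<close>

text \<open>Riemann-Roch spaces for arbitrary integer functions on the points, so that orders can be
  updated and scaled without constructing divisors.\<close>

definition sections :: "'f::field set \<Rightarrow> ('f point \<Rightarrow> int) \<Rightarrow> 'f set" where
  "sections K e = {f. \<forall>P\<in>points K. ord_ge P (- e P) f}"

lemma ord_ge_mult_right:
  assumes v: "v \<in> points K" and "s \<noteq> 0"
  shows "ord_ge v k (f * s) \<longleftrightarrow> ord_ge v (k - v s) f"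
  using point_mult[OF v _ assms(2), of f] assms(2) by (cases "f = 0") (auto simp: ord_ge_def)

lemma RR_space_sections: "RR_space K E = sections K (Poly_Mapping.lookup E)"
  by (auto simp: RR_space_def sections_def ord_ge_def)

lemma sections_0 [simp]: "0 \<in> sections K e"
  by (simp add: sections_def)

lemma sections_mono:
  assumes "\<And>P. P \<in> points K \<Longrightarrow> e P \<le> e' P" shows "sections K e \<subseteq> sections K e'"
  unfolding sections_def using assms by (auto elim!: ord_ge_mono)

lemma sections_add: "f \<in> sections K e \<Longrightarrow> g \<in> sections K e \<Longrightarrow> f + g \<in> sections K e"
  unfolding sections_def using ord_ge_add by blast

lemma sections_diff: "f \<in> sections K e \<Longrightarrow> g \<in> sections K e \<Longrightarrow> f - g \<in> sections K e"
  unfolding sections_def using ord_ge_diff by blast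

lemma sections_sum: "(\<And>i. i \<in> I \<Longrightarrow> f i \<in> sections K e) \<Longrightarrow> (\<Sum>i\<in>I. f i) \<in> sections K e"
  by (induction I rule: infinite_finite_induct) (auto intro: sections_add)

lemma sections_mult:
  assumes "f \<in> sections K e" "g \<in> sections K e'"
  shows "f * g \<in> sections K (\<lambda>P. e P + e' P)"
  unfolding sections_def
proof (intro CollectI ballI)
  fix P assume P: "P \<in> points K"
  have "ord_ge P (- e P + - e' P) (f * g)"
    using assms P by (intro ord_ge_mult[OF P]) (auto simp: sections_def)
  then show "ord_ge P (- (e P + e' P)) (f * g)" by simp
qed

lemma sections_power:
  assumes "f \<in> sections K e" shows "f ^ n \<in> sections K (\<lambda>P. int n * e P)"
proof (induction n)
  case 0
  then show ?case using ord_ge_one by (auto simp: sections_def)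
next
  case (Suc n)
  have "(\<lambda>P. int (Suc n) * e P) = (\<lambda>P. e P + int n * e P)" by (auto simp: algebra_simps)
  then show ?case using sections_mult[OF assms Suc.IH] by simp
qed

section \<open>Cardinalities of Riemann-Roch spaces\<close>

context finite_field_curve
begin

text \<open>A function without poles is constant by the existence of poles, and constants have order
  0 everywhere.\<close>

lemma sections_zero: "sections K (\<lambda>_. 0) = K"
proof
  show "sections K (\<lambda>_. 0) \<subseteq> K"
  proof
    fix g assume "g \<in> sections K (\<lambda>_. 0)"
    then have "0 \<le> v g" if "v \<in> points K" for v
      using that point_zero[OF that] by (cases "g = 0") (auto simp: sections_def ord_ge_def)
    then show "g \<in> K" using ex_pole[of g] by force
  qed
  show "K \<subseteq> sections K (\<lambda>_. 0)" using point_const by (force simp: sections_def ord_ge_def)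
qed

text \<open>After multiplication by a function of order \<open>e v + 1\<close> at \<open>v\<close>,
  each element of the larger space has a residue at \<open>v\<close>. Elements with equal residues
  differ by an element of the smaller space.\<close>

lemma card_sections_step:
  assumes v: "v \<in> points K" and fin: "finite (sections K e)"
  shows "finite (sections K (e(v := e v + 1))) \<and>
    card (sections K (e(v := e v + 1))) \<le> card (sections K e) * card K ^ point_degree K v"
proof -
  let ?L = "sections K e" and ?L' = "sections K (e(v := e v + 1))"
  obtain T where T: "finite T" "card T = card K ^ point_degree K v"
    "\<And>u. ord_ge v 0 u \<Longrightarrow> \<exists>a\<in>T. ord_ge v 1 (u - a)" using residue_system[OF v] by auto
  obtain t where t: "t \<noteq> 0" "v t = 1" by (rule point_uniformizer[OF v])
  define s where "s = (if e v + 1 \<ge> 0 then t ^ nat (e v + 1) else inverse (t ^ nat (- (e v + 1))))"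
  have s: "s \<noteq> 0" "v s = e v + 1"
    using t by (auto simp: s_def point_inverse[OF v] point_power[OF v])
  have "ord_ge v 0 (f * s)" if "f \<in> ?L'" for f
  proof -
    have "ord_ge v (- (e v + 1)) f" using that v by (auto simp: sections_def dest: bspec[of _ _ v])
    then have "ord_ge v (- (e v + 1) + (e v + 1)) (f * s)"
      using s by (intro ord_ge_mult[OF v]) (auto simp: ord_ge_def)
    then show ?thesis by simp
  qed
  then have "\<exists>a\<in>T. ord_ge v 1 (f * s - a)" if "f \<in> ?L'" for f using T(3) that by blast
  then obtain r where r: "\<And>f. f \<in> ?L' \<Longrightarrow> r f \<in> T" "\<And>f. f \<in> ?L' \<Longrightarrow> ord_ge v 1 (f * s - r f)" by metis
  \<comment> \<open>\<open>c f\<close> is a fixed element with the same residue as \<open>f\<close>.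
    It depends on \<open>r f\<close> only, so \<open>f\<close> is recovered from the pair of
    \<open>r f\<close> and \<open>f - c f\<close>.\<close>
  define c where "c f = inv_into ?L' r (r f)" for f
  have c: "c f \<in> ?L'" "r (c f) = r f" if "f \<in> ?L'" for f
    using that unfolding c_def by (auto intro: inv_into_into f_inv_into_f)
  have diff: "f - c f \<in> ?L" if f: "f \<in> ?L'" for f
  proof -
    have d: "f - c f \<in> ?L'" by (rule sections_diff[OF f c(1)[OF f]])
    have "ord_ge v 1 ((f * s - r f) - (c f * s - r f))"
      using r(2)[OF f] r(2)[OF c(1)[OF f]] c(2)[OF f] by (metis ord_ge_diff[OF v])
    then have "ord_ge v 1 ((f - c f) * s)" by (simp add: algebra_simps)
    then have "ord_ge v (- e v) (f - c f)"
      using ord_ge_mult_right[OF v s(1), of 1 "f - c f"] s(2) by simp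
    then show ?thesis using d by (auto simp: sections_def split: if_splits)
  qed
  have inj: "inj_on (\<lambda>f. (r f, f - c f)) ?L'"
  proof (rule inj_onI)
    fix f g assume "(r f, f - c f) = (r g, g - c g)"
    then have "r f = r g" "f - c f = g - c g" by auto
    moreover from this(1) have "c f = c g" by (simp only: c_def)
    ultimately show "f = g" by simp
  qed
  have img: "(\<lambda>f. (r f, f - c f)) ` ?L' \<subseteq> T \<times> ?L" using r(1) diff by blast
  have "finite (T \<times> ?L)" using T(1) fin by simp
  then show ?thesis
    using inj_on_finite[OF inj img] card_inj_on_le[OF inj img] T(2)
    by (simp add: card_cartesian_product mult.commute)
qed

lemma card_sections_single:
  assumes v: "v \<in> points K" and fin: "finite (sections K e)"
  shows "finite (sections K (e(v := e v + int n))) \<and>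
    card (sections K (e(v := e v + int n))) \<le> card (sections K e) * card K ^ (n * point_degree K v)"
proof (induction n)
  case (Suc n)
  let ?e = "e(v := e v + int n)"
  have eq: "e(v := e v + int (Suc n)) = ?e(v := ?e v + 1)" by auto
  have step: "finite (sections K (?e(v := ?e v + 1)))"
    "card (sections K (?e(v := ?e v + 1))) \<le> card (sections K ?e) * card K ^ point_degree K v"
    using card_sections_step[OF v, of ?e] Suc by blast+
  note step(2)
  also have "card (sections K ?e) * card K ^ point_degree K v
      \<le> card (sections K e) * card K ^ (n * point_degree K v) * card K ^ point_degree K v"
    by (rule mult_le_mono1) (use Suc in blast)
  also have "\<dots> = card (sections K e) * card K ^ (Suc n * point_degree K v)"
    by (simp add: power_add)
  finally show ?case using step(1) unfolding eq by blast
qed (use fin in simp)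

lemma card_sections_bound:
  fixes n :: "'f point \<Rightarrow> nat"
  assumes "finite Z" "Z \<subseteq> points K"
  shows "finite (sections K (\<lambda>P. if P \<in> Z then int (n P) else 0)) \<and>
    card (sections K (\<lambda>P. if P \<in> Z then int (n P) else 0))
      \<le> card K * card K ^ (\<Sum>P\<in>Z. n P * point_degree K P)"
  using assms
proof (induction Z)
  case empty
  then show ?case using sections_zero finite_K by simp
next
  case (insert v Z)
  let ?e = "\<lambda>P. if P \<in> Z then int (n P) else 0"
  have eq: "(\<lambda>P. if P \<in> insert v Z then int (n P) else 0) = ?e(v := ?e v + int (n v))"
    using insert.hyps by auto
  have v: "v \<in> points K" using insert.prems by simp
  have fin: "finite (sections K ?e)" using insert by simp
  have "card (sections K (?e(v := ?e v + int (n v)))) \<le> card (sections K ?e) * card K ^ (n v * point_degree K v)"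
    using card_sections_single[OF v fin] by blast
  also have "\<dots> \<le> card K * card K ^ (\<Sum>P\<in>Z. n P * point_degree K P) * card K ^ (n v * point_degree K v)"
    by (rule mult_le_mono1) (use insert in blast)
  also have "\<dots> = card K * card K ^ (\<Sum>P\<in>insert v Z. n P * point_degree K P)"
    using insert.hyps by (simp add: power_add)
  finally show ?case using card_sections_single[OF v fin, of "n v"] unfolding eq by blast
qed

text \<open>Finitely many functions have finitely many poles altogether, and the sum of the absolute
  orders bounds each pole order.\<close>

lemma finite_set_in_sections:
  assumes "finite T"
  shows "\<exists>Z n. finite Z \<and> Z \<subseteq> points K \<and> T \<subseteq> sections K (\<lambda>P. if P \<in> Z then int (n P) else 0)"
proof (intro exI conjI subsetI)
  let ?Z = "\<Union>a\<in>T. {P \<in> points K. P a < 0}" and ?n = "\<lambda>P. \<Sum>a\<in>T. nat \<bar>P a\<bar>"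
  show "finite ?Z" using assms finite_poles by auto
  show "P \<in> points K" if "P \<in> ?Z" for P using that by auto
  fix a assume a: "a \<in> T"
  have "- int (?n P) \<le> P a" for P
  proof -
    have "nat \<bar>P a\<bar> \<le> ?n P" using a assms by (intro member_le_sum) auto
    then show ?thesis by linarith
  qed
  then show "a \<in> sections K (\<lambda>P. if P \<in> ?Z then int (?n P) else 0)"
    using a by (auto simp: sections_def ord_ge_def not_less)
qed

text \<open>Representatives to order \<open>n + 1\<close> are the sums \<open>a + t * b\<close> with
  \<open>a\<close> from a system to order 1 and \<open>b\<close> from one to order
  \<open>n\<close>.\<close>

lemma local_residue_system:
  assumes v: "v \<in> points K"
  shows "\<exists>T. finite T \<and> card T = card K ^ (n * point_degree K v) \<and> (\<forall>a\<in>T. ord_ge v 0 a)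
    \<and> (\<forall>a\<in>T. \<forall>b\<in>T. ord_ge v (int n) (a - b) \<longrightarrow> a = b)"
proof (induction n)
  case 0
  show ?case by (rule exI[of _ "{0}"]) auto
next
  case (Suc n)
  then obtain T where T: "finite T" "card T = card K ^ (n * point_degree K v)" "\<And>a. a \<in> T \<Longrightarrow> ord_ge v 0 a"
    "\<And>a b. a \<in> T \<Longrightarrow> b \<in> T \<Longrightarrow> ord_ge v (int n) (a - b) \<Longrightarrow> a = b" by blast
  obtain S where S: "finite S" "card S = card K ^ point_degree K v" "\<And>a. a \<in> S \<Longrightarrow> ord_ge v 0 a"
    "\<And>a b. a \<in> S \<Longrightarrow> b \<in> S \<Longrightarrow> ord_ge v 1 (a - b) \<Longrightarrow> a = b" using residue_system[OF v] by blast
  obtain t where t: "t \<noteq> 0" "v t = 1" by (rule point_uniformizer[OF v])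
  have t1: "ord_ge v 1 t" using t by (simp add: ord_ge_def)
  have tT: "ord_ge v 1 (t * b)" if "ord_ge v 0 b" for b using ord_ge_mult[OF v t1 that] by simp
  let ?h = "\<lambda>(a, b). a + t * b"
  have sep: "a = a' \<and> b = b'"
    if ab: "a \<in> S" "a' \<in> S" "b \<in> T" "b' \<in> T" and ge: "ord_ge v (int (Suc n)) ((a + t * b) - (a' + t * b'))" for a a' b b'
  proof -
    have "ord_ge v 1 (((a + t * b) - (a' + t * b')) - (t * b - t * b'))"
      using ab T(3) by (intro ord_ge_diff[OF v] ord_ge_mono[OF ge] tT) auto
    then have aa: "a = a'" using S(4) ab by (simp add: algebra_simps)
    then have "ord_ge v (int (Suc n)) (t * (b - b'))" using ge by (simp add: algebra_simps)
    then have "ord_ge v (int n) (b - b')"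
      using ord_ge_mult_right[OF v t(1), of "int (Suc n)" "b - b'"] t(2) by (simp add: mult.commute)
    then show ?thesis using aa T(4) ab by blast
  qed
  have "inj_on ?h (S \<times> T)" using sep by (fastforce simp: inj_on_def)
  then have "card (?h ` (S \<times> T)) = card K ^ (Suc n * point_degree K v)"
    by (simp add: card_image card_cartesian_product S(2) T(2) power_add)
  moreover have "\<forall>a\<in>?h ` (S \<times> T). ord_ge v 0 a"
    using S(3) ord_ge_mono[OF tT[OF T(3)], of _ 0] by (auto intro!: ord_ge_add[OF v])
  moreover have "\<forall>a\<in>?h ` (S \<times> T). \<forall>b\<in>?h ` (S \<times> T). ord_ge v (int (Suc n)) (a - b) \<longrightarrow> a = b"
  proof (intro ballI impI)
    fix x y assume "x \<in> ?h ` (S \<times> T)" "y \<in> ?h ` (S \<times> T)" and ge: "ord_ge v (int (Suc n)) (x - y)"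
    then obtain a b a' b' where "x = a + t * b" "y = a' + t * b'" "a \<in> S" "a' \<in> S" "b \<in> T" "b' \<in> T" by auto
    then show "x = y" using sep ge by metis
  qed
  ultimately show ?case using S(1) T(1) by (intro exI[of _ "?h ` (S \<times> T)"]) auto
qed

text \<open>A Chinese remainder argument: weak approximation turns each family of local
  representatives into one function, and different families give incongruent functions.\<close>

lemma semilocal_residue_system:
  fixes n :: "'f point \<Rightarrow> nat"
  assumes Z: "finite Z" "Z \<subseteq> points K"
  shows "\<exists>T. finite T \<and> card T = card K ^ (\<Sum>P\<in>Z. n P * point_degree K P)
    \<and> (\<forall>a\<in>T. \<forall>P\<in>Z. ord_ge P 0 a)
    \<and> (\<forall>a\<in>T. \<forall>b\<in>T. (\<forall>P\<in>Z. ord_ge P (int (n P)) (a - b)) \<longrightarrow> a = b)"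
proof -
  have "\<forall>P\<in>Z. \<exists>T. finite T \<and> card T = card K ^ (n P * point_degree K P) \<and> (\<forall>a\<in>T. ord_ge P 0 a)
    \<and> (\<forall>a\<in>T. \<forall>b\<in>T. ord_ge P (int (n P)) (a - b) \<longrightarrow> a = b)"
    using local_residue_system Z(2) by blast
  then obtain U where U: "\<And>P. P \<in> Z \<Longrightarrow> finite (U P)"
    "\<And>P. P \<in> Z \<Longrightarrow> card (U P) = card K ^ (n P * point_degree K P)"
    "\<And>P a. P \<in> Z \<Longrightarrow> a \<in> U P \<Longrightarrow> ord_ge P 0 a"
    "\<And>P a b. P \<in> Z \<Longrightarrow> a \<in> U P \<Longrightarrow> b \<in> U P \<Longrightarrow> ord_ge P (int (n P)) (a - b) \<Longrightarrow> a = b" by metis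
  \<comment> \<open>A single precision that is at least \<open>n P\<close> at every point of
    \<open>Z\<close>, as weak approximation uses one order for all points.\<close>
  define N where "N = (\<Sum>P\<in>Z. n P)"
  have N: "n P \<le> N" if "P \<in> Z" for P unfolding N_def using Z that by (intro member_le_sum) auto
  have "\<forall>b. \<exists>a. \<forall>P\<in>Z. ord_ge P (int N) (a - b P)" using weak_approximation[OF Z] by blast
  then obtain \<alpha> where \<alpha>: "\<And>b P. P \<in> Z \<Longrightarrow> ord_ge P (int N) (\<alpha> b - b P)" by metis
  let ?B = "PiE Z U"
  have sep: "b = b'"
    if b: "b \<in> ?B" "b' \<in> ?B" and ge: "\<And>P. P \<in> Z \<Longrightarrow> ord_ge P (int (n P)) (\<alpha> b - \<alpha> b')" for b b'
  proof (rule PiE_ext[OF b])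
    fix P assume P: "P \<in> Z"
    then have PK: "P \<in> points K" using Z by auto
    have "ord_ge P (int (n P)) ((\<alpha> b - \<alpha> b') - (\<alpha> b - b P) + (\<alpha> b' - b' P))"
      by (intro ord_ge_add[OF PK] ord_ge_diff[OF PK ge[OF P]] ord_ge_mono[OF \<alpha>[OF P]]) (use N P in auto)
    then have "ord_ge P (int (n P)) (b P - b' P)" by (simp add: algebra_simps)
    then show "b P = b' P" using U(4)[OF P] b P by (auto simp: PiE_mem)
  qed
  have "inj_on \<alpha> ?B" by (rule inj_onI) (auto intro: sep)
  then have "card (\<alpha> ` ?B) = card K ^ (\<Sum>P\<in>Z. n P * point_degree K P)"
    using Z U(2) by (simp add: card_image card_PiE power_sum)
  moreover have "ord_ge P 0 (\<alpha> b)" if "b \<in> ?B" "P \<in> Z" for b P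
  proof -
    have PK: "P \<in> points K" using Z that by auto
    have "ord_ge P 0 ((\<alpha> b - b P) + b P)"
      using that U(3) by (intro ord_ge_add[OF PK] ord_ge_mono[OF \<alpha>]) (auto simp: PiE_mem)
    then show ?thesis by simp
  qed
  moreover have "finite (\<alpha> ` ?B)" using Z U(1) by (auto intro: finite_PiE)
  ultimately show ?thesis using sep by (intro exI[of _ "\<alpha> ` ?B"]) blast
qed

section \<open>Degrees of divisors and nonzero sections\<close>

lemma divisor_degree_superset:
  assumes "finite Z" "Poly_Mapping.keys D \<subseteq> Z"
  shows "divisor_degree K D = (\<Sum>P\<in>Z. Poly_Mapping.lookup D P * int (point_degree K P))"
  unfolding divisor_degree_def
  using assms by (intro sum.mono_neutral_left) (auto simp: in_keys_iff)

lemma divisor_degree_diff: "divisor_degree K (A - B) = divisor_degree K A - divisor_degree K B"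
proof -
  let ?Z = "Poly_Mapping.keys A \<union> Poly_Mapping.keys B"
  show ?thesis
    using divisor_degree_superset[of ?Z] keys_diff[of A B]
    by (simp add: lookup_minus left_diff_distrib sum_subtractf)
qed

lemma divisor_degree_add: "divisor_degree K (A + B) = divisor_degree K A + divisor_degree K B"
  using divisor_degree_diff[of "A + B" B] by simp

text \<open>
  The sums \<open>\<Sum> a\<^sub>k f\<^sup>k\<close> with digits \<open>a\<^sub>k\<close> in a residue system modulo the
  negative part of \<open>D\<close> are pairwise distinct and lie in a Riemann-Roch space whose dimension
  grows like \<open>m\<close> times the degree of the positive part.
\<close>

theorem degree_nonneg_if_section:
  assumes D: "D \<in> divisors K" and f: "f \<in> RR_space K D" "f \<noteq> 0"
  shows "divisor_degree K D \<ge> 0"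
proof -
  let ?D = "Poly_Mapping.lookup D"
  define Z where "Z = Poly_Mapping.keys D"
  define Y where "Y = {P \<in> Z. ?D P < 0}"
  define pos where "pos P = nat (?D P)" for P
  define neg where "neg P = nat (- ?D P)" for P
  let ?d = "point_degree K"
  have Z: "finite Z" "Z \<subseteq> points K" using D by (auto simp: Z_def divisors_def)
  have Y: "finite Y" "Y \<subseteq> points K" using Z by (auto simp: Y_def)
  have fD: "ord_ge P (- ?D P) f" if "P \<in> points K" for P
    using f(1) that unfolding RR_space_sections sections_def by auto
  obtain T where T: "finite T" "card T = card K ^ (\<Sum>P\<in>Y. neg P * ?d P)"
    "\<And>a P. a \<in> T \<Longrightarrow> P \<in> Y \<Longrightarrow> ord_ge P 0 a"
    "\<And>a b. a \<in> T \<Longrightarrow> b \<in> T \<Longrightarrow> (\<forall>P\<in>Y. ord_ge P (int (neg P)) (a - b)) \<Longrightarrow> a = b"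
    using semilocal_residue_system[OF Y, of neg] by metis
  obtain U n where U: "finite U" "U \<subseteq> points K"
    "T \<subseteq> sections K (\<lambda>P. if P \<in> U then int (n P) else 0)"
    using finite_set_in_sections[OF T(1)] by blast
  define W where "W = U \<union> Z"
  have W: "finite W" "W \<subseteq> points K" using U Z by (auto simp: W_def)
  define c where "c = (\<Sum>P\<in>W. (if P \<in> U then n P else 0) * ?d P)"
  define p where "p = (\<Sum>P\<in>W. pos P * ?d P)"
  let ?R = "{r. \<forall>P\<in>Y. ord_ge P 0 r}"
  have "card T \<le> card K ^ p"
  \<comment> \<open>The ring consists of the functions regular on the negative part of
    \<open>D\<close>. The pole bound for the digits contributes the constant
    \<open>card K * card K ^ c\<close>, and the powers of \<open>f\<close> contribute the rate
    \<open>card K ^ p\<close>.\<close>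
  proof (rule card_le_of_growth[of ?R f])
    show "unital_subring ?R" by (rule unital_subring_regular[OF Y(2)])
    \<comment> \<open>Being a section of \<open>D\<close>, \<open>f\<close> vanishes to order
      \<open>neg P\<close> on the negative part. So elements of \<open>T\<close> congruent modulo
      \<open>f\<close> are congruent modulo the negative part and coincide.\<close>
    have fY: "ord_ge P (int (neg P)) f" if "P \<in> Y" for P
      using fD[of P] that Y by (auto simp: neg_def Y_def)
    show "f \<in> ?R"
    proof (intro CollectI ballI)
      fix P assume "P \<in> Y"
      then show "ord_ge P 0 f" by (rule ord_ge_mono[OF fY]) simp
    qed
    show "T \<subseteq> ?R" using T(3) by blast
    show "a = b" if "a \<in> T" "b \<in> T" "r \<in> ?R" "a - b = f * r" for a b r
    proof (rule T(4)[OF that(1,2)], rule ballI)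
      fix P assume P: "P \<in> Y"
      then have "P \<in> points K" using Y by auto
      from ord_ge_mult[OF this fY[OF P], of 0 r] show "ord_ge P (int (neg P)) (a - b)"
        using that P by simp
    qed
    show "card ((\<lambda>a. \<Sum>k<m. a k * f ^ k) ` ({..<m} \<rightarrow>\<^sub>E T)) \<le> (card K * card K ^ c) * (card K ^ p) ^ m" for m
    proof -
      let ?n = "\<lambda>P. (if P \<in> U then n P else 0) + m * pos P"
      let ?L = "sections K (\<lambda>P. if P \<in> W then int (?n P) else 0)"
      have "(\<lambda>a. \<Sum>k<m. a k * f ^ k) ` ({..<m} \<rightarrow>\<^sub>E T) \<subseteq> ?L"
      proof (intro image_subsetI sections_sum)
        fix a k assume "a \<in> {..<m} \<rightarrow>\<^sub>E T" and k: "k \<in> {..<m}"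
        then have "a k \<in> sections K (\<lambda>P. if P \<in> U then int (n P) else 0)" using U(3) by (auto simp: PiE_mem)
        from sections_mult[OF this sections_power[OF f(1)[unfolded RR_space_sections], of k]]
        have "a k * f ^ k \<in> sections K (\<lambda>P. (if P \<in> U then int (n P) else 0) + int k * ?D P)" .
        moreover have "(if P \<in> U then int (n P) else 0) + int k * ?D P \<le> (if P \<in> W then int (?n P) else 0)"
          for P
        proof -
          have "int k * ?D P \<le> int k * int (pos P)" by (intro mult_left_mono) (auto simp: pos_def)
          also have "\<dots> \<le> int m * int (pos P)" using k by (intro mult_right_mono) auto
          finally have "int k * ?D P \<le> int m * int (pos P)" .
          moreover have "?D P = 0" if "P \<notin> W" using that by (simp add: W_def Z_def in_keys_iff)
          ultimately show ?thesis by (auto simp: W_def)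
        qed
        ultimately show "a k * f ^ k \<in> ?L" by (rule subsetD[OF sections_mono, rotated])
      qed
      then have "card ((\<lambda>a. \<Sum>k<m. a k * f ^ k) ` ({..<m} \<rightarrow>\<^sub>E T)) \<le> card ?L"
        using card_sections_bound[OF W, of ?n] by (intro card_mono) auto
      also have "\<dots> \<le> card K * card K ^ (\<Sum>P\<in>W. ?n P * ?d P)"
        using card_sections_bound[OF W, of ?n] by blast
      also have "(\<Sum>P\<in>W. ?n P * ?d P) = c + p * m"
        by (simp add: c_def p_def algebra_simps sum.distrib sum_distrib_left)
      finally show ?thesis by (simp add: power_add power_mult)
    qed
  qed (use f T in auto)
  \<comment> \<open>Both sides are powers of \<open>card K\<close>, which is at least 2, so the
    exponents can be compared.\<close>
  then have "(\<Sum>P\<in>Y. neg P * ?d P) \<le> p" using T(2) card_K by simp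
  moreover have "p = (\<Sum>P\<in>Z. pos P * ?d P)"
    unfolding p_def using W by (intro sum.mono_neutral_right) (auto simp: W_def Z_def pos_def in_keys_iff)
  moreover have "(\<Sum>P\<in>Y. neg P * ?d P) = (\<Sum>P\<in>Z. neg P * ?d P)"
    using Z by (intro sum.mono_neutral_left) (auto simp: Y_def neg_def)
  ultimately have "(\<Sum>P\<in>Z. neg P * ?d P) \<le> (\<Sum>P\<in>Z. pos P * ?d P)" by simp
  then have "int (\<Sum>P\<in>Z. neg P * ?d P) \<le> int (\<Sum>P\<in>Z. pos P * ?d P)" by (simp only: of_nat_le_iff)
  moreover have "divisor_degree K D = (\<Sum>P\<in>Z. int (pos P * ?d P) - int (neg P * ?d P))"
    unfolding divisor_degree_def Z_def[symmetric]
    by (intro sum.cong refl) (auto simp: pos_def neg_def simp flip: left_diff_distrib)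
  ultimately show ?thesis by (simp add: sum_subtractf)
qed

end

section \<open>Divisor classes\<close>

lemma RR_space_iff:
  "f \<in> RR_space K E \<longleftrightarrow> (\<forall>P\<in>points K. ord_ge P (- Poly_Mapping.lookup E P) f)"
  by (simp add: RR_space_sections sections_def)

lemma RR_space_minus_point:
  assumes "v \<in> points K"
  shows "f \<in> RR_space K (E - frag_of v) \<longleftrightarrow> f \<in> RR_space K E \<and> ord_ge v (1 - Poly_Mapping.lookup E v) f"
proof -
  have "- Poly_Mapping.lookup (E - frag_of v) P
      = (if P = v then 1 - Poly_Mapping.lookup E v else - Poly_Mapping.lookup E P)" for P
    by (simp add: lookup_minus lookup_single)
  moreover have "ord_ge v (- Poly_Mapping.lookup E v) f" if "ord_ge v (1 - Poly_Mapping.lookup E v) f"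
    by (rule ord_ge_mono[OF that]) simp
  ultimately show ?thesis using assms by (auto simp: RR_space_iff)
qed

section \<open>Linear equivalence and independence of representatives\<close>

lemma divisors_zero: "0 \<in> divisors K"
  by (simp add: divisors_def)

lemma divisors_add: "A \<in> divisors K \<Longrightarrow> B \<in> divisors K \<Longrightarrow> A + B \<in> divisors K"
  unfolding divisors_def using keys_add[of A B] by blast

lemma divisors_diff: "A \<in> divisors K \<Longrightarrow> B \<in> divisors K \<Longrightarrow> A - B \<in> divisors K"
  unfolding divisors_def using keys_diff[of A B] by blast

lemma divisors_point: "v \<in> points K \<Longrightarrow> frag_of v \<in> divisors K"
  by (simp add: divisors_def)

lemma linear_equivalence_iff:
  "(A, B) \<in> linear_equivalence K \<longleftrightarrow> A \<in> divisors K \<and> B \<in> divisors K \<and>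
     (\<exists>f. f \<noteq> 0 \<and> (\<forall>P\<in>points K. Poly_Mapping.lookup A P - Poly_Mapping.lookup B P = P f))"
  by (simp add: linear_equivalence_def lookup_minus)

lemma equiv_linear_equivalence: "equiv (divisors K) (linear_equivalence K)"
proof (rule equivI)
  show "linear_equivalence K \<subseteq> divisors K \<times> divisors K" by (auto simp: linear_equivalence_def)
  show "refl_on (divisors K) (linear_equivalence K)"
    using point_one by (force simp: refl_on_def linear_equivalence_iff intro: exI[of _ 1])
  show "sym (linear_equivalence K)"
  proof (rule symI)
    fix A B assume "(A, B) \<in> linear_equivalence K"
    then obtain f where f: "A \<in> divisors K" "B \<in> divisors K" "f \<noteq> 0"
      "\<And>P. P \<in> points K \<Longrightarrow> Poly_Mapping.lookup A P - Poly_Mapping.lookup B P = P f"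
      unfolding linear_equivalence_iff by blast
    have "Poly_Mapping.lookup B P - Poly_Mapping.lookup A P = P (inverse f)" if "P \<in> points K" for P
      using f(4)[OF that] point_inverse[OF that f(3)] by simp
    then show "(B, A) \<in> linear_equivalence K"
      unfolding linear_equivalence_iff using f(1-3) by (metis inverse_nonzero_iff_nonzero)
  qed
  show "trans (linear_equivalence K)"
  proof (rule transI)
    fix A B D assume "(A, B) \<in> linear_equivalence K" "(B, D) \<in> linear_equivalence K"
    then obtain f g where f: "A \<in> divisors K" "f \<noteq> 0"
      "\<And>P. P \<in> points K \<Longrightarrow> Poly_Mapping.lookup A P - Poly_Mapping.lookup B P = P f"
      and g: "D \<in> divisors K" "g \<noteq> 0"
      "\<And>P. P \<in> points K \<Longrightarrow> Poly_Mapping.lookup B P - Poly_Mapping.lookup D P = P g"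
      unfolding linear_equivalence_iff by blast
    have "Poly_Mapping.lookup A P - Poly_Mapping.lookup D P = P (f * g)" if "P \<in> points K" for P
      using f(3)[OF that] g(3)[OF that] point_mult[OF that f(2) g(2)] by simp
    then show "(A, D) \<in> linear_equivalence K"
      unfolding linear_equivalence_iff using f(1,2) g(1,2) by (metis mult_eq_0_iff)
  qed
qed

lemma divisor_class_members:
  assumes "a \<in> divisor_classes K" "A \<in> a"
  shows "A \<in> divisors K" "B \<in> a \<longleftrightarrow> (A, B) \<in> linear_equivalence K"
proof -
  obtain A0 where A0: "A0 \<in> divisors K" "a = linear_equivalence K `` {A0}"
    using assms(1) unfolding divisor_classes_def by (auto elim: quotientE)
  then have A: "(A0, A) \<in> linear_equivalence K" using assms(2) by simp
  then show "A \<in> divisors K" by (simp add: linear_equivalence_iff)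
  show "B \<in> a \<longleftrightarrow> (A, B) \<in> linear_equivalence K"
    using A A0(2) equiv_linear_equivalence[of K] unfolding equiv_def
    by (meson Image_singleton_iff symE transE)
qed

text \<open>Translation by \<open>C\<close> preserves linear equivalence in both directions, so it
  maps a class onto a full class.\<close>

lemma class_minus_divisor_class:
  assumes a: "a \<in> divisor_classes K" and C: "C \<in> divisors K"
  shows "class_minus a C \<in> divisor_classes K"
proof -
  obtain A where A: "A \<in> divisors K" "a = linear_equivalence K `` {A}"
    using a unfolding divisor_classes_def by (auto elim: quotientE)
  have shift: "(A - C, B - C) \<in> linear_equivalence K \<longleftrightarrow> (A, B) \<in> linear_equivalence K" for B
  proof -
    have "B - C \<in> divisors K \<longleftrightarrow> B \<in> divisors K"
      using divisors_diff[OF _ C] divisors_add[OF _ C] by (metis diff_add_cancel)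
    then show ?thesis using A(1) C by (simp add: linear_equivalence_iff lookup_minus divisors_diff)
  qed
  have "class_minus a C = linear_equivalence K `` {A - C}"
  proof
    show "class_minus a C \<subseteq> linear_equivalence K `` {A - C}"
      using shift by (auto simp: class_minus_def A(2))
    show "linear_equivalence K `` {A - C} \<subseteq> class_minus a C"
    proof
      fix B assume "B \<in> linear_equivalence K `` {A - C}"
      then have "B + C \<in> a" using shift[of "B + C"] A(2) by simp
      then show "B \<in> class_minus a C" unfolding class_minus_def by (metis add_diff_cancel image_eqI)
    qed
  qed
  then show ?thesis using quotientI[of "A - C" "divisors K"] A(1) C divisors_diff
    unfolding divisor_classes_def by metis
qed

lemma linear_equivalence_RR_space:
  assumes "h \<noteq> 0"
    and "\<forall>P\<in>points K. Poly_Mapping.lookup A P - Poly_Mapping.lookup B P = P h"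
  shows "f \<in> RR_space K A \<longleftrightarrow> f * h \<in> RR_space K B"
  unfolding RR_space_iff
proof (rule ball_cong[OF refl])
  fix P assume P: "P \<in> points K"
  then have "- Poly_Mapping.lookup B P - P h = - Poly_Mapping.lookup A P" using assms(2) by force
  then show "ord_ge P (- Poly_Mapping.lookup A P) f = ord_ge P (- Poly_Mapping.lookup B P) (f * h)"
    using ord_ge_mult_right[OF P assms(1)] by simp
qed

lemma jump_linear_equivalence:
  assumes "(A, B) \<in> linear_equivalence K" "RR_space K A \<noteq> RR_space K (A - frag_of v)"
  shows "RR_space K B \<noteq> RR_space K (B - frag_of v)"
proof -
  obtain h where h: "h \<noteq> 0"
    "\<forall>P\<in>points K. Poly_Mapping.lookup A P - Poly_Mapping.lookup B P = P h"
    using assms(1) unfolding linear_equivalence_iff by blast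
  have "\<forall>P\<in>points K. Poly_Mapping.lookup (A - frag_of v) P - Poly_Mapping.lookup (B - frag_of v) P = P h"
    using h(2) by (simp add: lookup_minus)
  then show ?thesis
    using linear_equivalence_RR_space[OF h] linear_equivalence_RR_space[OF h(1)] assms(2) by blast
qed

text \<open>Allows the existential condition on a class to be tested on any chosen representative:
  multiplication by one function carries both spaces to those of an equivalent divisor.\<close>

lemma Gamma_pt_iff:
  assumes "a \<in> divisor_classes K" "A \<in> a"
  shows "a \<in> Gamma_pt K v \<longleftrightarrow> RR_space K A \<noteq> RR_space K (A - frag_of v)"
proof
  assume "a \<in> Gamma_pt K v"
  then obtain B where B: "B \<in> a" "RR_space K B \<noteq> RR_space K (B - frag_of v)"
    unfolding Gamma_pt_def by blast
  have "(B, A) \<in> linear_equivalence K" using divisor_class_members(2)[OF assms(1) B(1)] assms(2) by simp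
  from jump_linear_equivalence[OF this B(2)] show "RR_space K A \<noteq> RR_space K (A - frag_of v)" .
qed (use assms in \<open>auto simp: Gamma_pt_def\<close>)

lemma Gamma_rel_iff:
  assumes "a \<in> Gamma_set K S" "A \<in> a" "C \<in> divisors K"
  shows "a \<in> Gamma_rel K v C S \<longleftrightarrow> RR_space K (A - C) \<noteq> RR_space K (A - C - frag_of v)"
proof -
  have a: "a \<in> divisor_classes K" using assms(1) by (simp add: Gamma_set_def)
  have "A - C \<in> class_minus a C" using assms(2) by (simp add: class_minus_def)
  from Gamma_pt_iff[OF class_minus_divisor_class[OF a assms(3)] this]
  show ?thesis using assms(1) by (simp add: Gamma_rel_def)
qed

lemma min_degree_le: "a \<in> G \<Longrightarrow> min_degree K G \<le> ereal (of_int (class_degree K a))"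
  unfolding min_degree_def by (rule INF_lower)

lemma min_degree_ge:
  "(\<And>a. a \<in> G \<Longrightarrow> k \<le> class_degree K a) \<Longrightarrow> ereal (of_int k) \<le> min_degree K G"
  unfolding min_degree_def by (rule INF_greatest) simp

lemma effective_RR_space_mono:
  assumes "effective A" shows "RR_space K (- C) \<subseteq> RR_space K (A - C)"
  unfolding RR_space_sections
  by (rule sections_mono) (use assms in \<open>auto simp: effective_def lookup_minus\<close>)

lemma RR_space_minus_point_subset: "v \<in> points K \<Longrightarrow> RR_space K (E - frag_of v) \<subseteq> RR_space K E"
  using RR_space_minus_point by blast

lemma RR_space_nonzero_if_ne:
  assumes "RR_space K E' \<subseteq> RR_space K E" "RR_space K E \<noteq> RR_space K E'"
  obtains f where "f \<in> RR_space K E" "f \<noteq> 0"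
proof -
  have "0 \<in> RR_space K E'" by (simp add: RR_space_sections)
  then show ?thesis using assms that by (metis subset_antisym subsetI)
qed

section \<open>Degrees of classes and bounds for their minima\<close>

context finite_field_curve
begin

lemma divisor_degree_point: "divisor_degree K (frag_of v) = int (point_degree K v)"
  by (simp add: divisor_degree_def)

text \<open>If \<open>A - B\<close> is the divisor of \<open>f\<close>, the inverse of
  \<open>f\<close> is a nonzero section of \<open>A - B\<close>, whose degree is therefore
  nonnegative. Symmetry gives equality.\<close>

lemma degree_linear_equivalence:
  assumes "(A, B) \<in> linear_equivalence K"
  shows "divisor_degree K A = divisor_degree K B"
proof -
  have le: "divisor_degree K B \<le> divisor_degree K A" if AB: "(A, B) \<in> linear_equivalence K" for A B
  proof -
    obtain f where f: "A \<in> divisors K" "B \<in> divisors K" "f \<noteq> 0"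
      "\<forall>P\<in>points K. Poly_Mapping.lookup A P - Poly_Mapping.lookup B P = P f"
      using AB unfolding linear_equivalence_iff by blast
    have "inverse f \<in> RR_space K (A - B)"
      unfolding RR_space_iff
    proof
      fix P assume "P \<in> points K"
      then show "ord_ge P (- Poly_Mapping.lookup (A - B) P) (inverse f)"
        using f(3,4) by (simp add: ord_ge_def lookup_minus point_inverse[of P K])
    qed
    from degree_nonneg_if_section[OF divisors_diff[OF f(1,2)] this]
    have "0 \<le> divisor_degree K (A - B)" using f(3) by simp
    then show ?thesis by (simp add: divisor_degree_diff)
  qed
  have "(B, A) \<in> linear_equivalence K"
    using assms equiv_linear_equivalence[of K] unfolding equiv_def by (meson symE)
  then show ?thesis using le[OF assms] le[of B A] by simp
qed

lemma class_degree_eq: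
  assumes "a \<in> divisor_classes K" "A \<in> a"
  shows "class_degree K a = divisor_degree K A"
proof -
  have "divisor_degree K B = divisor_degree K A" if "B \<in> a" for B
    using degree_linear_equivalence[of A B] divisor_class_members(2)[OF assms] that by simp
  then have "divisor_degree K ` a = (\<lambda>_. divisor_degree K A) ` a" by (rule image_cong[OF refl])
  also have "\<dots> = {divisor_degree K A}" using assms(2) by blast
  finally have "divisor_degree K ` a = {divisor_degree K A}" .
  then show ?thesis by (simp add: class_degree_def)
qed

text \<open>If \<open>f\<close> vanished more than required at some \<open>P\<close>, it would be a
  nonzero section of \<open>A - P\<close>, a divisor of negative degree. Hence \<open>A\<close> is
  the divisor of the inverse of \<open>f\<close>.\<close>

lemma degree_zero_section_principal:
  assumes A: "A \<in> divisors K" "divisor_degree K A = 0" and f: "f \<in> RR_space K A" "f \<noteq> 0"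
  shows "(A, 0) \<in> linear_equivalence K"
proof -
  have "Poly_Mapping.lookup A P = P (inverse f)" if P: "P \<in> points K" for P
  proof (rule ccontr)
    assume ne: "Poly_Mapping.lookup A P \<noteq> P (inverse f)"
    have "- Poly_Mapping.lookup A P \<le> P f" using f P by (auto simp: RR_space_iff ord_ge_def)
    then have "ord_ge P (1 - Poly_Mapping.lookup A P) f"
      using ne point_inverse[OF P f(2)] by (auto simp: ord_ge_def)
    then have "f \<in> RR_space K (A - frag_of P)" using f(1) RR_space_minus_point[OF P] by blast
    then have "0 \<le> divisor_degree K (A - frag_of P)"
      by (rule degree_nonneg_if_section[OF divisors_diff[OF A(1) divisors_point[OF P]] _ f(2)])
    then show False
      using A(2) point_degree_pos[OF P] by (simp add: divisor_degree_diff divisor_degree_point)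
  qed
  then show ?thesis using A(1) f(2) divisors_zero by (auto simp: linear_equivalence_iff intro!: exI[of _ "inverse f"])
qed

lemma Gamma_pt_degree:
  assumes v: "v \<in> points K" and a: "a \<in> Gamma_pt K v"
  shows "class_degree K a \<ge> 0" "class_degree K a = 0 \<Longrightarrow> 0 \<in> a"
proof -
  have cl: "a \<in> divisor_classes K" using a by (simp add: Gamma_pt_def)
  obtain A where A: "A \<in> a" "RR_space K A \<noteq> RR_space K (A - frag_of v)"
    using a unfolding Gamma_pt_def by blast
  obtain f where f: "f \<in> RR_space K A" "f \<noteq> 0"
    using RR_space_nonzero_if_ne[OF RR_space_minus_point_subset[OF v] A(2)] .
  have AK: "A \<in> divisors K" by (rule divisor_class_members(1)[OF cl A(1)])
  show "class_degree K a \<ge> 0"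
    using degree_nonneg_if_section[OF AK f] class_degree_eq[OF cl A(1)] by simp
  show "0 \<in> a" if "class_degree K a = 0"
    using degree_zero_section_principal[OF AK _ f] that class_degree_eq[OF cl A(1)]
      divisor_class_members(2)[OF cl A(1)] by simp
qed

text \<open>The degrees involved are nonnegative integers, so the value 0 is attained; an empty set
  would give infinity. A class of degree 0 with a nonzero section is the zero class, and its
  representative 0 gives the claim.\<close>

lemma gamma_pt_eq_0:
  assumes v: "v \<in> points K" "v \<in> S" and C: "C \<in> divisors K" and 0: "gamma_pt K v C S = 0"
  shows "RR_space K (- C) \<noteq> RR_space K (- C - frag_of v)"
proof -
  have deg: "class_degree K a \<ge> 0" "class_degree K a = 0 \<Longrightarrow> 0 \<in> a" if "a \<in> Gamma_rel K v C S" for a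
    using that Gamma_pt_degree[OF v(1)] v(2) by (auto simp: Gamma_rel_def Gamma_set_def)
  have "\<exists>a\<in>Gamma_rel K v C S. class_degree K a = 0"
  proof (rule ccontr)
    assume "\<not> ?thesis"
    then have "1 \<le> class_degree K a" if "a \<in> Gamma_rel K v C S" for a
      using deg(1)[OF that] that by force
    then have "ereal (of_int 1) \<le> gamma_pt K v C S"
      unfolding gamma_pt_def by (rule min_degree_ge)
    then show False using 0 by simp
  qed
  then obtain a where a: "a \<in> Gamma_rel K v C S" "0 \<in> a" using deg(2) by blast
  moreover have "a \<in> Gamma_set K S" using a(1) by (simp add: Gamma_rel_def)
  ultimately show ?thesis using Gamma_rel_iff[of a K S 0 C v] C by simp
qed

lemma effective_degree_pos:
  assumes "effective A" "A \<in> divisors K" "A \<noteq> 0"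
  shows "divisor_degree K A \<ge> 1"
proof -
  have nn: "0 \<le> Poly_Mapping.lookup A P * int (point_degree K P)" for P
    using assms(1) by (simp add: effective_def)
  obtain P where P: "P \<in> Poly_Mapping.keys A" using assms(3) by (metis all_not_in_conv keys_eq_empty)
  then have "0 < Poly_Mapping.lookup A P * int (point_degree K P)"
  proof (intro mult_pos_pos)
    show "0 < Poly_Mapping.lookup A P"
      using assms(1) P by (simp add: effective_def in_keys_iff order_less_le)
    show "0 < int (point_degree K P)" using assms(2) P point_degree_pos[of P] by (auto simp: divisors_def)
  qed
  also have "\<dots> \<le> divisor_degree K A"
    unfolding divisor_degree_def using P nn by (intro member_le_sum) auto
  finally show ?thesis by simp
qed

lemma Gamma_star_witness:
  assumes "a \<in> Gamma_star K C S"
  obtains A where "A \<in> a" "A \<in> divisors K" "effective A" "RR_space K (A - C) \<noteq> RR_space K (- C)"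
    "class_degree K a = divisor_degree K A" "a \<in> Gamma_set K S" "a \<in> divisor_classes K"
proof -
  obtain A where A: "A \<in> a" "effective A" "RR_space K (A - C) \<noteq> RR_space K (- C)"
    and a: "a \<in> Gamma_set K S" using assms unfolding Gamma_star_def by blast
  have cl: "a \<in> divisor_classes K" using a by (simp add: Gamma_set_def)
  show ?thesis
    by (rule that[OF A(1) divisor_class_members(1)[OF cl A(1)] A(2,3) class_degree_eq[OF cl A(1)] a cl])
qed

text \<open>For \<open>A = 0\<close> the two spaces coincide, so a witness is effective and nonzero.
  In particular this minimum is not lost when 0 is removed from the final set.\<close>

lemma gamma_star_ge_1: "gamma_star K C S \<ge> 1"
proof -
  have "1 \<le> class_degree K a" if a: "a \<in> Gamma_star K C S" for a
  proof -
    obtain A where A: "A \<in> divisors K" "effective A" "RR_space K (A - C) \<noteq> RR_space K (- C)"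
      "class_degree K a = divisor_degree K A" using Gamma_star_witness[OF a] by metis
    then have "A \<noteq> 0" by auto
    then show ?thesis using effective_degree_pos A by simp
  qed
  then have "ereal (of_int 1) \<le> gamma_star K C S" unfolding gamma_star_def by (rule min_degree_ge)
  then show ?thesis by (simp add: one_ereal_def)
qed

text \<open>A witness \<open>A\<close> has a nonzero section of \<open>A - C\<close>, hence degree
  at least that of \<open>C\<close>.\<close>

lemma gamma_star_ge_degree:
  assumes C: "C \<in> divisors K" shows "gamma_star K C S \<ge> ereal (of_int (divisor_degree K C))"
  unfolding gamma_star_def
proof (rule min_degree_ge)
  fix a assume a: "a \<in> Gamma_star K C S"
  obtain A where A: "A \<in> divisors K" "effective A" "RR_space K (A - C) \<noteq> RR_space K (- C)"
    "class_degree K a = divisor_degree K A" using Gamma_star_witness[OF a] by metis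
  obtain f where f: "f \<in> RR_space K (A - C)" "f \<noteq> 0"
    using RR_space_nonzero_if_ne[OF effective_RR_space_mono[OF A(2)] A(3)] .
  then have "0 \<le> divisor_degree K (A - C)"
    by (rule degree_nonneg_if_section[OF divisors_diff[OF A(1) C]])
  then show "divisor_degree K C \<le> class_degree K a" using A(4) by (simp add: divisor_degree_diff)
qed

section \<open>Riemann-Roch spaces at a rational point\<close>

lemma RR_space_const_mult: "c \<in> K \<Longrightarrow> f \<in> RR_space K E \<Longrightarrow> c * f \<in> RR_space K E"
  using sections_mult[of c K "\<lambda>_. 0" f "Poly_Mapping.lookup E"] sections_zero
  by (simp add: RR_space_sections)

text \<open>Since \<open>f\<close> has the least admissible order at \<open>v\<close>, the quotient
  \<open>g / f\<close> is regular there. Its residue is a constant \<open>c\<close> by rationality,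
  and subtracting \<open>c * f\<close> from \<open>g\<close> raises the order.\<close>

lemma RR_space_codimension_le_1:
  assumes v: "v \<in> rational_points K"
    and f: "f \<in> RR_space K E" "f \<notin> RR_space K (E - frag_of v)" and g: "g \<in> RR_space K E"
  shows "\<exists>c\<in>K. g - c * f \<in> RR_space K (E - frag_of v)"
proof -
  have vK: "v \<in> points K" using v by (simp add: rational_points_def)
  let ?k = "- Poly_Mapping.lookup E v"
  have f0: "f \<noteq> 0" using f(2) by (auto simp: RR_space_sections)
  have ge: "ord_ge v ?k f" "ord_ge v ?k g" using f(1) g vK by (auto simp: RR_space_iff)
  have "\<not> ord_ge v (1 - Poly_Mapping.lookup E v) f" using f RR_space_minus_point[OF vK] by blast
  then have vf: "v f = ?k" using ge f0 by (auto simp: ord_ge_def)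
  have "ord_ge v 0 (g / f)"
    using ord_ge_mult_right[OF vK f0, of ?k "g / f"] ge(2) f0 vf by simp
  then obtain c where c: "c \<in> K" "ord_ge v 1 (g / f - c)" using rational_residue[OF v] by blast
  have "(g / f - c) * f = g - c * f" using f0 by (simp add: field_simps)
  then have "ord_ge v (1 - Poly_Mapping.lookup E v) (g - c * f)"
    using ord_ge_mult_right[OF vK f0, of "1 - Poly_Mapping.lookup E v" "g / f - c"] c(2) vf by simp
  moreover have "c * f \<in> RR_space K E" by (rule RR_space_const_mult[OF c(1) f(1)])
  then have "g - c * f \<in> RR_space K E" using sections_diff g by (simp add: RR_space_sections)
  ultimately show ?thesis using c(1) RR_space_minus_point[OF vK] by blast
qed

text \<open>If \<open>L(-C)\<close> dropped too, an element \<open>f\<close> outside the smaller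
  space would generate \<open>L(A - C)\<close> modulo \<open>L(A - C - v) = L(-C - v)\<close>. Then
  \<open>L(A - C)\<close> would lie inside \<open>L(-C)\<close>, contradicting the assumed
  difference.\<close>

lemma last_difference_is_jump:
  assumes v: "v \<in> rational_points K" and A: "effective A"
    and ne: "RR_space K (A - C) \<noteq> RR_space K (- C)"
    and eq: "RR_space K (A - C - frag_of v) = RR_space K (- C - frag_of v)"
  shows "RR_space K (A - C) \<noteq> RR_space K (A - C - frag_of v)"
    and "RR_space K (- C) = RR_space K (- C - frag_of v)"
proof -
  have vK: "v \<in> points K" using v by (simp add: rational_points_def)
  note sub = RR_space_minus_point_subset[OF vK] effective_RR_space_mono[OF A]
  show "RR_space K (A - C) \<noteq> RR_space K (A - C - frag_of v)"
    using ne eq sub(1)[of "- C"] sub(2)[of K C] by blast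
  show "RR_space K (- C) = RR_space K (- C - frag_of v)"
  proof (rule ccontr)
    assume "RR_space K (- C) \<noteq> RR_space K (- C - frag_of v)"
    then obtain f where f: "f \<in> RR_space K (- C)" "f \<notin> RR_space K (- C - frag_of v)"
      using sub(1)[of "- C"] by blast
    have "g \<in> RR_space K (- C)" if g: "g \<in> RR_space K (A - C)" for g
    proof -
      have "f \<in> RR_space K (A - C)" "f \<notin> RR_space K (A - C - frag_of v)" using f eq sub(2)[of K C] by blast+
      then obtain c where c: "c \<in> K" "g - c * f \<in> RR_space K (A - C - frag_of v)"
        using RR_space_codimension_le_1[OF v _ _ g] by blast
      then have "g - c * f \<in> RR_space K (- C)" using eq sub(1)[of "- C"] by blast
      moreover have "c * f \<in> RR_space K (- C)"
        by (rule RR_space_const_mult[OF c(1) f(1)])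
      ultimately have "(g - c * f) + c * f \<in> RR_space K (- C)"
        using sections_add by (metis RR_space_sections)
      then show ?thesis by simp
    qed
    then show False using ne sub(2)[of K C] by blast
  qed
qed

end

section \<open>Lower bound by adding the points one at a time\<close>

theorem proposition6p1:
  fixes K :: "'f::field set"
    and S :: "'f point set"
    and C :: "'f divisor"
    and r :: nat
    and Q :: "nat \<Rightarrow> 'f point"
    and Cs :: "nat \<Rightarrow> 'f divisor"
  assumes "finite_field_curve K"
    and "finite S" and "S \<subseteq> rational_points K"
    and "C \<in> divisors K"
    and "\<And>i. i < r \<Longrightarrow> Q i \<in> S"
    and "Cs 0 = C"
    and "\<And>i. i < r \<Longrightarrow> Cs (Suc i) = Cs i + frag_of (Q i)"
  shows "gamma_star K C S \<ge>
           Min (((\<lambda>i. gamma_pt K (Q i) (Cs i) S) ` {..<r} \<union> {gamma_star K (Cs r) S}) - {0})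
       \<and> gamma_star K (Cs r) S \<ge> ereal (of_int (divisor_degree K C + int r))"
proof
  interpret finite_field_curve K by fact
  have Q: "Q i \<in> rational_points K" "Q i \<in> points K" if "i < r" for i
    using assms(3,5) that by (auto simp: rational_points_def)
  have Cs: "Cs i \<in> divisors K \<and> divisor_degree K (Cs i) = divisor_degree K C + int i" if "i \<le> r" for i
    using that
  proof (induction i)
    case (Suc i)
    then have "point_degree K (Q i) = 1" using Q[of i] by (simp add: rational_points_def)
    moreover have "Cs i + frag_of (Q i) \<in> divisors K"
      using Suc Q[of i] by (intro divisors_add divisors_point) auto
    ultimately show ?case
      using Suc assms(7)[of i] by (simp add: divisor_degree_add divisor_degree_point)
  qed (use assms in simp)
  show "gamma_star K (Cs r) S \<ge> ereal (of_int (divisor_degree K C + int r))"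
    using gamma_star_ge_degree[of "Cs r" S] Cs[of r] by simp
  let ?M = "((\<lambda>i. gamma_pt K (Q i) (Cs i) S) ` {..<r} \<union> {gamma_star K (Cs r) S}) - {0}"
  have Min_le: "Min ?M \<le> x" if "x \<in> ?M" for x using that by (intro Min_le) auto
  show "gamma_star K C S \<ge> Min ?M"
    unfolding gamma_star_def[of K C] min_degree_def
  proof (rule INF_greatest)
    fix a assume "a \<in> Gamma_star K C S"
    then obtain A where A: "A \<in> a" "effective A" "RR_space K (A - C) \<noteq> RR_space K (- C)"
      and a: "a \<in> Gamma_set K S" by (rule Gamma_star_witness)
    let ?ne = "\<lambda>i. RR_space K (A - Cs i) \<noteq> RR_space K (- Cs i)"
    show "Min ?M \<le> ereal (of_int (class_degree K a))"
    proof (cases "?ne r")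
      case True
      \<comment> \<open>The same effective representative \<open>A\<close> witnesses membership for
        the last divisor of the chain.\<close>
      then have "a \<in> Gamma_star K (Cs r) S" using A a by (auto simp: Gamma_star_def)
      then have "gamma_star K (Cs r) S \<le> ereal (of_int (class_degree K a))"
        unfolding gamma_star_def by (rule min_degree_le)
      moreover have "gamma_star K (Cs r) S \<in> ?M" using gamma_star_ge_1[of "Cs r" S] by auto
      ultimately show ?thesis using Min_le order_trans by blast
    next
      case False
      have "?ne 0" using A(3) assms(6) by simp
      \<comment> \<open>The spaces differ at index 0 and agree at index \<open>r\<close>, so
        somewhere a difference turns into equality.\<close>
      then obtain i where i: "i < r" "?ne i" "\<not> ?ne (Suc i)"
        using False inc_induct[of 0 r "\<lambda>i. \<not> ?ne i"] by blast
      have CsD: "Cs i \<in> divisors K" using Cs i by simp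
      have "A - Cs (Suc i) = A - Cs i - frag_of (Q i)" "- Cs (Suc i) = - Cs i - frag_of (Q i)"
        using assms(7)[OF i(1)] by simp_all
      with i(3) have "RR_space K (A - Cs i - frag_of (Q i)) = RR_space K (- Cs i - frag_of (Q i))" by simp
      note jump = last_difference_is_jump[OF Q(1)[OF i(1)] A(2) i(2) this]
      \<comment> \<open>A value 0 would require \<open>L(-C)\<close> for \<open>C = Cs i\<close> to
        drop at \<open>Q i\<close>, which it does not; so this value survives the removal of
        0.\<close>
      have "gamma_pt K (Q i) (Cs i) S \<noteq> 0"
        using gamma_pt_eq_0[OF Q(2)[OF i(1)] assms(5)[OF i(1)] CsD] jump(2) by blast
      then have "gamma_pt K (Q i) (Cs i) S \<in> ?M" using i(1) by auto
      moreover have "gamma_pt K (Q i) (Cs i) S \<le> ereal (of_int (class_degree K a))"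
        unfolding gamma_pt_def using Gamma_rel_iff[OF a A(1) CsD] jump(1) by (intro min_degree_le) blast
      ultimately show ?thesis using Min_le order_trans by blast
    qed
  qed
qed

end
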